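(* Let $(A,\Delta)$ be an algebraic quantum group (a regular multiplier Hopf algebra with integrals) and let $B=\widehat A$ be its dual, with the canonical pairing $\langle\,\cdot\,,\,\cdot\,\rangle:A\times B\to\mathbb C$. There is a unique element $V$ in the multiplier algebra $M(B\otimes A)$ such that $$\langle V,a\otimes b\rangle=\langle a,b\rangle$$ for all $a\in A$ and $b\in B$. Moreover, $(\iota\otimes S)V$ and $(S\otimes\iota)V$ are also in $M(B\otimes A)$.
   Context: All algebras are associative algebras over $\mathbb C$, possibly non-unital, with non-degenerate product; $M(A)$ is the multiplier algebra of $A$; $\iota$ denotes identity maps. Regular multiplier Hopf algebra: an algebra $A$ with a homomorphism $\Delta:A\to M(A\otimes A)$ such that $\Delta(a)(1\otimes a')$, $(a\otimes 1)\Delta(a')$, $\Delta(a)(a'\otimes 1)$ and $(1\otimes a)\Delta(a')$ lie in $A\otimes A$ for all $a,a'$; $\Delta$ is coassociative, $(a\otimes1\otimes1)(\Delta\otimes\iota)(\Delta(c)(1\otimes a'))=((\iota\otimes\Delta)((a\otimes1)\Delta(c)))(1\otimes1\otimes a')$; and the maps $a\otimes a'\mapsto\Delta(a)(1\otimes a')$, $a\otimes a'\mapsto(a\otimes1)\Delta(a')$, and the same two maps for the flipped coproduct, are bijections of $A\otimes A$. It has a unique counit $\varepsilon:A\to\mathbb C$ (a homomorphism) and antipode $S:A\to A$ (a bijective anti-homomorphism). Such algebras have local units. A left integral is a non-zero linear functional $\varphi$ on $A$ with $(\iota\otimes\varphi)\Delta(a)=\varphi(a)1$ in $M(A)$ for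 all $a$; a right integral is a non-zero $\psi$ with $(\psi\otimes\iota)\Delta(a)=\psi(a)1$. Integrals are faithful and unique up to a scalar. "With integrals" means that such functionals exist; fix a left integral $\varphi$. Dual: $B=\widehat A=\{\varphi(\,\cdot\,c):c\in A\}$, a space of functionals on $A$, with $\langle a,b\rangle=b(a)$. Its product is $\langle a,bb'\rangle=\langle\Delta(a),b\otimes b'\rangle$; its coproduct $\Delta:B\to M(B\otimes B)$ is determined by $\langle a\otimes a',(b'\otimes1)\Delta(b)\rangle=\langle\Delta(a)(1\otimes a'),b'\otimes b\rangle$ and $\langle a\otimes a',\Delta(b)(1\otimes b')\rangle=\langle(a\otimes1)\Delta(a'),b\otimes b'\rangle$. Then $(B,\Delta)$ is again an algebraic quantum group; $S$ also denotes its antipode, and $\langle S(a),b\rangle=\langle a,S(b)\rangle$. There are unital left and right actions given by $\langle a',a\triangleright b\rangle=\langle a'a,b\rangle$, $\langle a',b\triangleleft a\rangle=\langle aa',b\rangle$, $\langle b\triangleright a,b'\rangle=\langle a,b'b\rangle$, $\langle a\triangleleft b,b'\rangle=\langle a,bb'\rangle$. The pairing of $B\otimes A$ with $A\otimes B$ is $\langle b\otimes a,a'\otimes b'\rangle=\langle a',b\rangle\langle a,b'\rangle$; it extends uniquely to $M(B\otimes A)\times(A\otimes B)$ by $\langle m,(b\triangleright a')\otimes(a\triangleright b')\rangle=\langle m(b\otimes a),a'\otimes b'\rangle$, and then also $\langle m,(a'\triangleleft b)\otimes(b'\triangleleft a)\rangle=\langle(b\otimes a)m,a'\otimes b'\rangle$.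 $(\iota\otimes S)V$ and $(S\otimes\iota)V$ are the elements determined by $\langle(\iota\otimes S)V,a\otimes b\rangle=\langle V,a\otimes S(b)\rangle$ and $\langle(S\otimes\iota)V,a\otimes b\rangle=\langle V,S(a)\otimes b\rangle$ for all $a\in A$, $b\in B$; that they are in $M(B\otimes A)$ means that elements of $M(B\otimes A)$ with these pairings exist. *)

theory Defs
  imports Complex_Main "HOL-Library.Poly_Mapping"
begin

section \<open>Complex vector spaces and algebras\<close>

class complex_vector = ab_group_add +
  fixes scaleC :: "complex \<Rightarrow> 'a \<Rightarrow> 'a"  (infixr "*\<^sub>C" 75)
  assumes scaleC_add_right: "c *\<^sub>C (x + y) = c *\<^sub>C x + c *\<^sub>C y"
    and scaleC_add_left: "(c + d) *\<^sub>C x = c *\<^sub>C x + d *\<^sub>C x"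
    and scaleC_scaleC [simp]: "c *\<^sub>C (d *\<^sub>C x) = (c * d) *\<^sub>C x"
    and scaleC_one [simp]: "1 *\<^sub>C x = x"

global_interpretation complex_vector: vector_space "scaleC :: complex \<Rightarrow> 'a \<Rightarrow> 'a::complex_vector"
  by unfold_locales (simp_all add: scaleC_add_right scaleC_add_left)

text \<open>The library class \<open>ring\<close> does not require a unit.\<close>

class complex_algebra = complex_vector + ring +
  assumes mult_scaleC_left [simp]: "(c *\<^sub>C x) * y = c *\<^sub>C (x * y)"
    and mult_scaleC_right [simp]: "x * (c *\<^sub>C y) = c *\<^sub>C (x * y)"

class nondegenerate_algebra = complex_algebra +
  assumes nondegenerate_left: "(\<forall>y. x * y = 0) \<Longrightarrow> x = 0"
    and nondegenerate_right: "(\<forall>x. x * y = 0) \<Longrightarrow> y = 0"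

instantiation complex :: nondegenerate_algebra
begin
definition scaleC_complex :: "complex \<Rightarrow> complex \<Rightarrow> complex" where
  "scaleC_complex c x = c * x"
instance
  by standard (auto simp: scaleC_complex_def algebra_simps dest: spec[of _ 1])
end

abbreviation clinear :: "('a::complex_vector \<Rightarrow> 'b::complex_vector) \<Rightarrow> bool" where
  "clinear \<equiv> Vector_Spaces.linear scaleC scaleC"

definition cbilinear :: "('a::complex_vector \<Rightarrow> 'b::complex_vector \<Rightarrow> 'c::complex_vector) \<Rightarrow> bool" where
  "cbilinear f \<longleftrightarrow> (\<forall>x. clinear (f x)) \<and> (\<forall>y. clinear (\<lambda>x. f x y))"

lemma clinear_iff:
  "clinear f \<longleftrightarrow> (\<forall>x y. f (x + y) = f x + f y) \<and> (\<forall>c x. f (c *\<^sub>C x) = c *\<^sub>C f x)"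
  by (auto simp: Vector_Spaces.linear_iff complex_vector.vector_space_axioms)

lemma clinear_add: "clinear f \<Longrightarrow> f (x + y) = f x + f y"
  by (simp add: clinear_iff)

lemma clinear_scale: "clinear f \<Longrightarrow> f (c *\<^sub>C x) = c *\<^sub>C f x"
  by (simp add: clinear_iff)

lemma clinear_0: "clinear f \<Longrightarrow> f 0 = 0"
  by (metis clinear_iff complex_vector.scale_zero_left)

lemma cbilinear_iff:
  "cbilinear f \<longleftrightarrow>
    (\<forall>x y z. f (x + y) z = f x z + f y z) \<and> (\<forall>x y z. f x (y + z) = f x y + f x z) \<and>
    (\<forall>c x y. f (c *\<^sub>C x) y = c *\<^sub>C f x y) \<and> (\<forall>c x y. f x (c *\<^sub>C y) = c *\<^sub>C f x y)"
  unfolding cbilinear_def clinear_iff by blast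


section \<open>Tensor products\<close>

definition free_scale :: "complex \<Rightarrow> ('k \<Rightarrow>\<^sub>0 complex) \<Rightarrow> ('k \<Rightarrow>\<^sub>0 complex)" where
  "free_scale c = Poly_Mapping.map ((*) c)"

lemma lookup_free_scale [simp]: "Poly_Mapping.lookup (free_scale c f) k = c * Poly_Mapping.lookup f k"
  unfolding free_scale_def by (simp add: Poly_Mapping.map.rep_eq when_def)

global_interpretation free_vector: vector_space "free_scale :: complex \<Rightarrow> ('k \<Rightarrow>\<^sub>0 complex) \<Rightarrow> _"
  by unfold_locales (auto intro!: poly_mapping_eqI simp: lookup_add algebra_simps)

definition tensor_relations :: "('a::complex_vector \<times> 'b::complex_vector \<Rightarrow>\<^sub>0 complex) set" where
  "tensor_relations =
     {Poly_Mapping.single (x + x', y) 1 - (Poly_Mapping.single (x, y) 1 + Poly_Mapping.single (x', y) 1) | x x' y. True}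
   \<union> {Poly_Mapping.single (x, y + y') 1 - (Poly_Mapping.single (x, y) 1 + Poly_Mapping.single (x, y') 1) | x y y'. True}
   \<union> {Poly_Mapping.single (c *\<^sub>C x, y) 1 - free_scale c (Poly_Mapping.single (x, y) 1) | c x y. True}
   \<union> {Poly_Mapping.single (x, c *\<^sub>C y) 1 - free_scale c (Poly_Mapping.single (x, y) 1) | c x y. True}"

definition tensor_eq ::
    "('a::complex_vector \<times> 'b::complex_vector \<Rightarrow>\<^sub>0 complex) \<Rightarrow> ('a \<times> 'b \<Rightarrow>\<^sub>0 complex) \<Rightarrow> bool" where
  "tensor_eq s t \<longleftrightarrow> s - t \<in> free_vector.span tensor_relations"

lemma equivp_tensor_eq: "equivp (tensor_eq :: ('a::complex_vector \<times> 'b::complex_vector \<Rightarrow>\<^sub>0 complex) \<Rightarrow> _)"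
  (is "equivp ?R")
proof (rule equivpI)
  show "reflp ?R"
    by (auto simp: reflp_def tensor_eq_def free_vector.span_zero)
  show "symp ?R"
    unfolding tensor_eq_def
  proof (rule sympI)
    fix s t :: "'a \<times> 'b \<Rightarrow>\<^sub>0 complex"
    assume "s - t \<in> free_vector.span tensor_relations"
    then have "- (s - t) \<in> free_vector.span tensor_relations" by (rule free_vector.span_neg)
    then show "t - s \<in> free_vector.span tensor_relations" by simp
  qed
  show "transp ?R"
    unfolding tensor_eq_def
  proof (rule transpI)
    fix s t u :: "'a \<times> 'b \<Rightarrow>\<^sub>0 complex"
    assume "s - t \<in> free_vector.span tensor_relations" and "t - u \<in> free_vector.span tensor_relations"
    then have "(s - t) + (t - u) \<in> free_vector.span tensor_relations" by (rule free_vector.span_add)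
    then show "s - u \<in> free_vector.span tensor_relations" by simp
  qed
qed

quotient_type (overloaded) ('a, 'b) tensor =
    "'a::complex_vector \<times> 'b::complex_vector \<Rightarrow>\<^sub>0 complex" / tensor_eq
  by (rule equivp_tensor_eq)

instantiation tensor :: (complex_vector, complex_vector) complex_vector
begin
lift_definition zero_tensor :: "('a, 'b) tensor" is 0 .
lift_definition plus_tensor :: "('a, 'b) tensor \<Rightarrow> ('a, 'b) tensor \<Rightarrow> ('a, 'b) tensor" is "(+)"
  unfolding tensor_eq_def by (simp only: add_diff_add free_vector.span_add)
lift_definition uminus_tensor :: "('a, 'b) tensor \<Rightarrow> ('a, 'b) tensor" is uminus
  unfolding tensor_eq_def by (simp only: minus_diff_minus free_vector.span_neg)
lift_definition minus_tensor :: "('a, 'b) tensor \<Rightarrow> ('a, 'b) tensor \<Rightarrow> ('a, 'b) tensor" is "(-)"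
proof -
  fix s s' t t' :: "'a \<times> 'b \<Rightarrow>\<^sub>0 complex"
  assume "tensor_eq s s'" "tensor_eq t t'"
  then have "(s - s') - (t - t') \<in> free_vector.span tensor_relations"
    unfolding tensor_eq_def by (rule free_vector.span_diff)
  also have "(s - s') - (t - t') = (s - t) - (s' - t')" by (simp only: algebra_simps)
  finally show "tensor_eq (s - t) (s' - t')" unfolding tensor_eq_def .
qed
lift_definition scaleC_tensor :: "complex \<Rightarrow> ('a, 'b) tensor \<Rightarrow> ('a, 'b) tensor" is free_scale
  unfolding tensor_eq_def
  by (simp only: free_vector.span_scale free_vector.scale_right_diff_distrib[symmetric])
instance
proof
  have eq: "tensor_eq s t" if "s = t" for s t :: "'a \<times> 'b \<Rightarrow>\<^sub>0 complex"
    using that by (simp add: tensor_eq_def free_vector.span_zero)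
  fix x y z :: "('a, 'b) tensor" and c d :: complex
  show "x + y + z = x + (y + z)" by transfer (rule eq, simp add: algebra_simps)
  show "x + y = y + x" by transfer (rule eq, simp add: algebra_simps)
  show "0 + x = x" by transfer (rule eq, simp)
  show "- x + x = 0" by transfer (rule eq, simp)
  show "x - y = x + - y" by transfer (rule eq, simp)
  show "c *\<^sub>C (x + y) = c *\<^sub>C x + c *\<^sub>C y"
    by transfer (rule eq, simp add: free_vector.scale_right_distrib)
  show "(c + d) *\<^sub>C x = c *\<^sub>C x + d *\<^sub>C x"
    by transfer (rule eq, simp add: free_vector.scale_left_distrib)
  show "c *\<^sub>C (d *\<^sub>C x) = (c * d) *\<^sub>C x" by transfer (rule eq, simp)
  show "1 *\<^sub>C x = x" by transfer (rule eq, simp)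
qed
end

lift_definition pure_tensor :: "'a::complex_vector \<Rightarrow> 'b::complex_vector \<Rightarrow> ('a, 'b) tensor"  (infixl "\<otimes>" 70)
  is "\<lambda>x y. Poly_Mapping.single (x, y) 1" .

lemma cbilinear_pure_tensor: "cbilinear (\<otimes>)"
proof -
  have base: "s - t \<in> tensor_relations \<Longrightarrow> tensor_eq s t" for s t :: "'a \<times> 'b \<Rightarrow>\<^sub>0 complex"
    by (simp add: tensor_eq_def free_vector.span_base)
  show ?thesis
    unfolding cbilinear_iff
  proof (intro conjI allI)
    fix x x' :: 'a and y y' :: 'b and c :: complex
    show "(x + x') \<otimes> y = x \<otimes> y + x' \<otimes> y"
      by transfer (rule base, unfold tensor_relations_def, blast)
    show "x \<otimes> (y + y') = x \<otimes> y + x \<otimes> y'"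
      by transfer (rule base, unfold tensor_relations_def, blast)
    show "(c *\<^sub>C x) \<otimes> y = c *\<^sub>C (x \<otimes> y)"
      by transfer (rule base, unfold tensor_relations_def, blast)
    show "x \<otimes> (c *\<^sub>C y) = c *\<^sub>C (x \<otimes> y)"
      by transfer (rule base, unfold tensor_relations_def, blast)
  qed
qed

lemma pure_tensor_simps:
  "(x + x') \<otimes> y = x \<otimes> y + x' \<otimes> y"
  "x \<otimes> (y + y') = x \<otimes> y + x \<otimes> y'"
  "(c *\<^sub>C x) \<otimes> y = c *\<^sub>C (x \<otimes> y)"
  "x \<otimes> (c *\<^sub>C y) = c *\<^sub>C (x \<otimes> y)"
  using cbilinear_pure_tensor unfolding cbilinear_iff by blast+

definition free_lift :: "('k \<Rightarrow> 'c::complex_vector) \<Rightarrow> ('k \<Rightarrow>\<^sub>0 complex) \<Rightarrow> 'c" where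
  "free_lift f s = (\<Sum>k\<in>Poly_Mapping.keys s. Poly_Mapping.lookup s k *\<^sub>C f k)"

text \<open>
  The linear map on the tensor product induced by a bilinear map \<open>f\<close>; only meaningful for
  bilinear \<open>f\<close>, for which it does not depend on the chosen representative.
\<close>

definition tensor_lift ::
    "('a::complex_vector \<Rightarrow> 'b::complex_vector \<Rightarrow> 'c::complex_vector) \<Rightarrow> ('a, 'b) tensor \<Rightarrow> 'c" where
  "tensor_lift f t = free_lift (case_prod f) (rep_tensor t)"

lemma free_lift_superset:
  "finite K \<Longrightarrow> Poly_Mapping.keys s \<subseteq> K \<Longrightarrow> free_lift f s = (\<Sum>k\<in>K. Poly_Mapping.lookup s k *\<^sub>C f k)"
  unfolding free_lift_def by (rule sum.mono_neutral_left) (auto simp: in_keys_iff)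

lemma free_lift_add: "free_lift f (s + t) = free_lift f s + free_lift f t"
proof -
  let ?K = "Poly_Mapping.keys s \<union> Poly_Mapping.keys t"
  have K: "Poly_Mapping.keys (s + t) \<subseteq> ?K" by (rule Poly_Mapping.keys_add)
  show ?thesis
    by (simp add: free_lift_superset[OF _ K] free_lift_superset[of ?K s] free_lift_superset[of ?K t]
        lookup_add scaleC_add_left sum.distrib)
qed

lemma free_lift_scale: "free_lift f (free_scale c s) = c *\<^sub>C free_lift f s"
proof -
  have K: "Poly_Mapping.keys (free_scale c s) \<subseteq> Poly_Mapping.keys s" by (auto simp: in_keys_iff)
  show ?thesis
    by (simp add: free_lift_superset[OF finite_keys K] free_lift_def[of f s] complex_vector.scale_sum_right)
qed

lemma free_lift_diff: "free_lift f (s - t) = free_lift f s - free_lift f t"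
  using free_lift_add[of f "s - t" t] by (simp add: algebra_simps)

lemma free_lift_single: "free_lift f (Poly_Mapping.single k 1) = f k"
  by (simp add: free_lift_def)

lemma free_lift_cong_tensor_eq:
  assumes f: "cbilinear f" and st: "tensor_eq s t"
  shows "free_lift (case_prod f) s = free_lift (case_prod f) t"
proof -
  have "free_lift (case_prod f) u = 0" if "u \<in> free_vector.span tensor_relations" for u
    using that
  proof (induction rule: free_vector.span_induct_alt)
    case base
    show ?case by (simp add: free_lift_def)
  next
    case (step c u v)
    have "free_lift (case_prod f) u = 0"
      using step(1) f unfolding tensor_relations_def cbilinear_iff
      by (auto simp: free_lift_diff free_lift_add free_lift_scale free_lift_single)
    then show ?case using step by (simp add: free_lift_add free_lift_scale)
  qed
  then show ?thesis using st unfolding tensor_eq_def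
    by (metis free_lift_diff right_minus_eq)
qed

lemma tensor_lift_abs:
  "cbilinear f \<Longrightarrow> tensor_lift f (abs_tensor s) = free_lift (case_prod f) s"
  unfolding tensor_lift_def
  by (erule free_lift_cong_tensor_eq) (rule Quotient3_rep_abs[OF Quotient3_tensor], simp add: tensor_eq_def free_vector.span_zero)

lemma tensor_lift_pure: "cbilinear f \<Longrightarrow> tensor_lift f (x \<otimes> y) = f x y"
  by (simp add: pure_tensor.abs_eq tensor_lift_abs free_lift_single)

lemma clinear_tensor_lift:
  assumes "cbilinear f" shows "clinear (tensor_lift f)"
  unfolding clinear_iff
proof (intro conjI allI)
  fix s t :: "('a, 'b) tensor" and c :: complex
  show "tensor_lift f (s + t) = tensor_lift f s + tensor_lift f t"
    by (induct s; induct t) (simp add: plus_tensor.abs_eq tensor_lift_abs assms free_lift_add)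
  show "tensor_lift f (c *\<^sub>C t) = c *\<^sub>C tensor_lift f t"
    by (induct t) (simp add: scaleC_tensor.abs_eq tensor_lift_abs assms free_lift_scale)
qed

lemma tensor_induct [case_names pure add]:
  assumes pure: "\<And>x y. P (x \<otimes> y)" and add: "\<And>s t. P s \<Longrightarrow> P t \<Longrightarrow> P (s + t)"
  shows "P t"
proof -
  have P0: "P 0"
    using pure[of 0 0] pure_tensor_simps(3)[of 0 "0::'a" "0::'b"] by (simp add: complex_vector.scale_zero_left)
  have "P (abs_tensor s)" for s
  proof (induction s rule: Poly_Mapping.update_induct)
    case const
    show ?case using P0 by (simp add: zero_tensor.abs_eq)
  next
    case (update s k v)
    obtain x y where k: "k = (x, y)" by (cases k)
    have "Poly_Mapping.update k v s = s + free_scale v (Poly_Mapping.single (x, y) 1)"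
      using update(1)
      by (auto intro!: poly_mapping_eqI simp: k lookup_single lookup_add lookup_update when_def in_keys_iff)
    then have "abs_tensor (Poly_Mapping.update k v s) = abs_tensor s + (v *\<^sub>C x) \<otimes> y"
      by (subst pure_tensor_simps(3)) (simp only: pure_tensor.abs_eq scaleC_tensor.abs_eq plus_tensor.abs_eq)
    then show ?case using add[OF update(3) pure] by simp
  qed
  then show ?thesis by (metis Quotient3_abs_rep[OF Quotient3_tensor])
qed


lemma cbilinear_pureI:
  "clinear f \<Longrightarrow> clinear g \<Longrightarrow> cbilinear (\<lambda>x y. f x \<otimes> g y)"
  unfolding cbilinear_iff clinear_iff by (simp add: pure_tensor_simps)

definition tensor_map ::
    "('a::complex_vector \<Rightarrow> 'c::complex_vector) \<Rightarrow> ('b::complex_vector \<Rightarrow> 'd::complex_vector) \<Rightarrow>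
      ('a, 'b) tensor \<Rightarrow> ('c, 'd) tensor" where
  "tensor_map f g = tensor_lift (\<lambda>x y. f x \<otimes> g y)"

definition tensor_flip :: "('a::complex_vector, 'b::complex_vector) tensor \<Rightarrow> ('b, 'a) tensor" where
  "tensor_flip = tensor_lift (\<lambda>x y. y \<otimes> x)"

definition tensor_assoc ::
    "(('a::complex_vector, 'b::complex_vector) tensor, 'c::complex_vector) tensor \<Rightarrow> ('a, ('b, 'c) tensor) tensor" where
  "tensor_assoc = tensor_lift (\<lambda>s z. tensor_lift (\<lambda>x y. x \<otimes> (y \<otimes> z)) s)"

definition tensor_assoc_inv ::
    "('a::complex_vector, ('b::complex_vector, 'c::complex_vector) tensor) tensor \<Rightarrow> (('a, 'b) tensor, 'c) tensor" where
  "tensor_assoc_inv = tensor_lift (\<lambda>x t. tensor_lift (\<lambda>y z. (x \<otimes> y) \<otimes> z) t)"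

lemma tensor_map_pure:
  "clinear f \<Longrightarrow> clinear g \<Longrightarrow> tensor_map f g (x \<otimes> y) = f x \<otimes> g y"
  by (simp add: tensor_map_def tensor_lift_pure cbilinear_pureI)

lemma clinear_tensor_map: "clinear f \<Longrightarrow> clinear g \<Longrightarrow> clinear (tensor_map f g)"
  by (simp add: tensor_map_def clinear_tensor_lift cbilinear_pureI)

lemma cbilinear_flip_pure: "cbilinear (\<lambda>x y. y \<otimes> x)"
  by (simp add: cbilinear_iff pure_tensor_simps)

lemma tensor_flip_pure [simp]: "tensor_flip (x \<otimes> y) = y \<otimes> x"
  by (simp add: tensor_flip_def tensor_lift_pure cbilinear_flip_pure)

lemma clinear_tensor_flip: "clinear tensor_flip"
  by (simp add: tensor_flip_def clinear_tensor_lift cbilinear_flip_pure)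

lemma cbilinear_assoc_pure:
  "cbilinear (\<lambda>x y. x \<otimes> (y \<otimes> z))" "cbilinear (\<lambda>y z. (x \<otimes> y) \<otimes> z)"
  by (simp_all add: cbilinear_iff pure_tensor_simps)

lemma cbilinear_tensor_assoc:
  "cbilinear (\<lambda>s z. tensor_lift (\<lambda>x y. x \<otimes> (y \<otimes> z)) s)"
  unfolding cbilinear_def
proof (intro conjI allI)
  fix z :: 'c
  show "clinear (tensor_lift (\<lambda>x y. x \<otimes> (y \<otimes> z)))"
    by (rule clinear_tensor_lift) (rule cbilinear_assoc_pure)
next
  note lin = clinear_tensor_lift[OF cbilinear_assoc_pure(1)]
  fix s
  show "clinear (\<lambda>z. tensor_lift (\<lambda>x y. x \<otimes> (y \<otimes> z)) s)"
    unfolding clinear_iff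
  proof (induction s rule: tensor_induct)
    case (pure x y)
    show ?case by (simp only: tensor_lift_pure cbilinear_assoc_pure) (simp add: pure_tensor_simps)
  next
    case (add s t)
    then show ?case by (simp add: clinear_add[OF lin] scaleC_add_right algebra_simps)
  qed
qed

lemma cbilinear_tensor_assoc_inv:
  "cbilinear (\<lambda>x t. tensor_lift (\<lambda>y z. (x \<otimes> y) \<otimes> z) t)"
  unfolding cbilinear_def
proof (intro conjI allI)
  fix x :: 'a
  show "clinear (tensor_lift (\<lambda>y z. (x \<otimes> y) \<otimes> z))"
    by (rule clinear_tensor_lift) (rule cbilinear_assoc_pure)
next
  note lin = clinear_tensor_lift[OF cbilinear_assoc_pure(2)]
  fix t
  show "clinear (\<lambda>x. tensor_lift (\<lambda>y z. (x \<otimes> y) \<otimes> z) t)"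
    unfolding clinear_iff
  proof (induction t rule: tensor_induct)
    case (pure y z)
    show ?case by (simp only: tensor_lift_pure cbilinear_assoc_pure) (simp add: pure_tensor_simps)
  next
    case (add s t)
    then show ?case by (simp add: clinear_add[OF lin] scaleC_add_right algebra_simps)
  qed
qed

lemma tensor_assoc_pure [simp]: "tensor_assoc ((x \<otimes> y) \<otimes> z) = x \<otimes> (y \<otimes> z)"
  by (simp add: tensor_assoc_def tensor_lift_pure cbilinear_tensor_assoc cbilinear_assoc_pure)

lemma tensor_assoc_inv_pure [simp]: "tensor_assoc_inv (x \<otimes> (y \<otimes> z)) = (x \<otimes> y) \<otimes> z"
  by (simp add: tensor_assoc_inv_def tensor_lift_pure cbilinear_tensor_assoc_inv cbilinear_assoc_pure)

lemma clinear_tensor_assoc: "clinear tensor_assoc"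
  unfolding tensor_assoc_def by (rule clinear_tensor_lift) (rule cbilinear_tensor_assoc)

lemma clinear_tensor_assoc_inv: "clinear tensor_assoc_inv"
  unfolding tensor_assoc_inv_def by (rule clinear_tensor_lift) (rule cbilinear_tensor_assoc_inv)

lemma tensor_flip_add [simp]: "tensor_flip (s + t) = tensor_flip s + tensor_flip t"
  by (rule clinear_add[OF clinear_tensor_flip])

lemma tensor_flip_scale [simp]: "tensor_flip (c *\<^sub>C t) = c *\<^sub>C tensor_flip t"
  by (rule clinear_scale[OF clinear_tensor_flip])

lemma tensor_assoc_add [simp]: "tensor_assoc (s + t) = tensor_assoc s + tensor_assoc t"
  by (rule clinear_add[OF clinear_tensor_assoc])

lemma tensor_assoc_scale [simp]: "tensor_assoc (c *\<^sub>C t) = c *\<^sub>C tensor_assoc t"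
  by (rule clinear_scale[OF clinear_tensor_assoc])

lemma tensor_assoc_inv_add [simp]: "tensor_assoc_inv (s + t) = tensor_assoc_inv s + tensor_assoc_inv t"
  by (rule clinear_add[OF clinear_tensor_assoc_inv])

lemma tensor_assoc_inv_scale [simp]: "tensor_assoc_inv (c *\<^sub>C t) = c *\<^sub>C tensor_assoc_inv t"
  by (rule clinear_scale[OF clinear_tensor_assoc_inv])

lemma tensor_induct_pair [case_names pure add_left add_right]:
  assumes "\<And>x y x' y'. P (x \<otimes> y) (x' \<otimes> y')"
    and "\<And>s s' t. P s t \<Longrightarrow> P s' t \<Longrightarrow> P (s + s') t"
    and "\<And>s t t'. P s t \<Longrightarrow> P s t' \<Longrightarrow> P s (t + t')"
  shows "P s t"
proof (induction s rule: tensor_induct)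
  case (pure x y)
  show ?case by (induction t rule: tensor_induct) (use assms in auto)
qed (use assms in auto)

lemma tensor_flip_flip [simp]: "tensor_flip (tensor_flip t) = t"
  by (induction t rule: tensor_induct) simp_all

lemma tensor_assoc_inverse [simp]: "tensor_assoc_inv (tensor_assoc t) = t"
proof (induction t rule: tensor_induct)
  case (pure s z)
  show ?case
    by (induction s rule: tensor_induct) (simp_all add: pure_tensor_simps)
qed simp

lemma tensor_assoc_inv_inverse [simp]: "tensor_assoc (tensor_assoc_inv t) = t"
proof (induction t rule: tensor_induct)
  case (pure x s)
  show ?case
    by (induction s rule: tensor_induct) (simp_all add: pure_tensor_simps)
qed simp


section \<open>The tensor product of algebras\<close>

lemma clinear_mult:
  "clinear (\<lambda>y. x * y)" "clinear (\<lambda>x. x * y)" for x y :: "'a::complex_algebra"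
  by (simp_all add: clinear_iff algebra_simps)

instantiation tensor :: (complex_algebra, complex_algebra) complex_algebra
begin

definition times_tensor :: "('a, 'b) tensor \<Rightarrow> ('a, 'b) tensor \<Rightarrow> ('a, 'b) tensor" where
  "s * t = tensor_lift (\<lambda>x y. tensor_map ((*) x) ((*) y) t) s"

lemma cbilinear_times_tensor:
  "cbilinear (\<lambda>(x::'a) (y::'b). tensor_map ((*) x) ((*) y) t)"
proof (induction t rule: tensor_induct)
  case (pure x' y')
  show ?case by (simp add: cbilinear_iff tensor_map_pure clinear_mult pure_tensor_simps algebra_simps)
next
  case (add s t)
  have "tensor_map ((*) x) ((*) y) (s + t) = tensor_map ((*) x) ((*) y) s + tensor_map ((*) x) ((*) y) t"
    for x :: 'a and y :: 'b
    using clinear_tensor_map[OF clinear_mult(1) clinear_mult(1)] unfolding clinear_iff by blast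
  then show ?case using add by (simp add: cbilinear_iff scaleC_add_right)
qed

lemma clinear_times_tensor:
  "clinear (\<lambda>t. s * t)" "clinear (\<lambda>s. s * t)" for s t :: "('a, 'b) tensor"
proof -
  show left: "clinear (\<lambda>s. s * t)" for t :: "('a, 'b) tensor"
    unfolding times_tensor_def by (rule clinear_tensor_lift) (rule cbilinear_times_tensor)
  show "clinear (\<lambda>t. s * t)"
  proof (induction s rule: tensor_induct)
    case (pure x y)
    have "x \<otimes> y * t = tensor_map ((*) x) ((*) y) t" for t
      by (simp add: times_tensor_def tensor_lift_pure cbilinear_times_tensor)
    then show ?case by (simp add: clinear_tensor_map clinear_mult)
  next
    case (add s s')
    have "(s + s') * t = s * t + s' * t" for t
      using left unfolding clinear_iff by blast
    then show ?case using add by (simp add: clinear_iff scaleC_add_right)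
  qed
qed

lemma mult_pure_tensor: "(x \<otimes> y) * (x' \<otimes> y') = (x * x') \<otimes> (y * y')" for x x' :: 'a and y y' :: 'b
  unfolding times_tensor_def
  by (subst tensor_lift_pure[OF cbilinear_times_tensor]) (rule tensor_map_pure[OF clinear_mult(1) clinear_mult(1)])

instance
proof
  fix s t u :: "('a, 'b) tensor" and c :: complex
  note lin = clinear_times_tensor[unfolded clinear_iff]
  show addl: "(s + t) * u = s * u + t * u" for s t u :: "('a, 'b) tensor" by (simp add: lin)
  show addr: "s * (t + u) = s * t + s * u" for s t u :: "('a, 'b) tensor" by (simp add: lin)
  show "(c *\<^sub>C s) * t = c *\<^sub>C (s * t)" by (simp add: lin)
  show "s * (c *\<^sub>C t) = c *\<^sub>C (s * t)" by (simp add: lin)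
  show "s * t * u = s * (t * u)"
  proof (induction s t rule: tensor_induct_pair)
    case (pure x y x' y')
    show ?case
      by (induction u rule: tensor_induct) (simp_all add: mult_pure_tensor mult.assoc addr)
  qed (simp_all add: addl addr)
qed

end


section \<open>Multiplier algebras\<close>

text \<open>
  A multiplier \<open>m\<close> is given by the pair \<open>(L, R)\<close> of the maps \<open>x \<mapsto> m x\<close> and \<open>x \<mapsto> x m\<close>.
\<close>

definition is_multiplier :: "('a::complex_algebra \<Rightarrow> 'a) \<times> ('a \<Rightarrow> 'a) \<Rightarrow> bool" where
  "is_multiplier = (\<lambda>(L, R). clinear L \<and> clinear R \<and>
    (\<forall>x y. L (x * y) = L x * y) \<and> (\<forall>x y. R (x * y) = x * R y) \<and> (\<forall>x y. x * L y = R x * y))"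

lemma is_multiplier_iff:
  "is_multiplier m \<longleftrightarrow>
    (\<forall>x y. fst m (x + y) = fst m x + fst m y) \<and> (\<forall>c x. fst m (c *\<^sub>C x) = c *\<^sub>C fst m x) \<and>
    (\<forall>x y. snd m (x + y) = snd m x + snd m y) \<and> (\<forall>c x. snd m (c *\<^sub>C x) = c *\<^sub>C snd m x) \<and>
    (\<forall>x y. fst m (x * y) = fst m x * y) \<and> (\<forall>x y. snd m (x * y) = x * snd m y) \<and>
    (\<forall>x y. x * fst m y = snd m x * y)"
  by (cases m) (simp add: is_multiplier_def clinear_iff)

typedef (overloaded) 'a multiplier = "{m :: ('a::complex_algebra \<Rightarrow> 'a) \<times> ('a \<Rightarrow> 'a). is_multiplier m}"
  by (rule exI[of _ "(\<lambda>x. x, \<lambda>x. x)"]) (simp add: is_multiplier_iff)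

setup_lifting type_definition_multiplier

lift_definition lmul :: "'a::complex_algebra multiplier \<Rightarrow> 'a \<Rightarrow> 'a" is fst .
lift_definition rmul :: "'a::complex_algebra \<Rightarrow> 'a multiplier \<Rightarrow> 'a" is "\<lambda>x m. snd m x" .

lemma multiplier_eqI:
  "(\<And>x. lmul m x = lmul n x) \<Longrightarrow> (\<And>x. rmul x m = rmul x n) \<Longrightarrow> m = n"
  by transfer (auto intro: prod_eqI)

instantiation multiplier :: (complex_algebra) complex_algebra
begin
lift_definition zero_multiplier :: "'a multiplier" is "(\<lambda>x. 0, \<lambda>x. 0)"
  by (simp add: is_multiplier_iff complex_vector.scale_zero_right)
lift_definition plus_multiplier :: "'a multiplier \<Rightarrow> 'a multiplier \<Rightarrow> 'a multiplier"
  is "\<lambda>m n. (\<lambda>x. fst m x + fst n x, \<lambda>x. snd m x + snd n x)"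
  by (auto simp: is_multiplier_iff algebra_simps scaleC_add_right)
lift_definition uminus_multiplier :: "'a multiplier \<Rightarrow> 'a multiplier"
  is "\<lambda>m. (\<lambda>x. - fst m x, \<lambda>x. - snd m x)"
  by (auto simp: is_multiplier_iff complex_vector.scale_minus_right)
lift_definition minus_multiplier :: "'a multiplier \<Rightarrow> 'a multiplier \<Rightarrow> 'a multiplier"
  is "\<lambda>m n. (\<lambda>x. fst m x - fst n x, \<lambda>x. snd m x - snd n x)"
  by (auto simp: is_multiplier_iff algebra_simps complex_vector.scale_right_diff_distrib)
lift_definition scaleC_multiplier :: "complex \<Rightarrow> 'a multiplier \<Rightarrow> 'a multiplier"
  is "\<lambda>c m. (\<lambda>x. c *\<^sub>C fst m x, \<lambda>x. c *\<^sub>C snd m x)"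
  by (auto simp: is_multiplier_iff scaleC_add_right mult.commute)
lift_definition times_multiplier :: "'a multiplier \<Rightarrow> 'a multiplier \<Rightarrow> 'a multiplier"
  is "\<lambda>m n. (\<lambda>x. fst m (fst n x), \<lambda>x. snd n (snd m x))"
  by (auto simp: is_multiplier_iff)
instance
  by standard
    (transfer; auto simp: is_multiplier_iff scaleC_add_right scaleC_add_left algebra_simps)+
end

instantiation multiplier :: (complex_algebra) monoid_mult
begin
lift_definition one_multiplier :: "'a multiplier" is "(\<lambda>x. x, \<lambda>x. x)"
  by (simp add: is_multiplier_iff)
instance
  by standard (transfer; auto)+
end

lift_definition mult_of :: "'a::complex_algebra \<Rightarrow> 'a multiplier"
  is "\<lambda>a. (\<lambda>x. a * x, \<lambda>x. x * a)"
  by (simp add: is_multiplier_iff algebra_simps)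

text \<open>
  For a non-degenerate algebra \<open>mult_of\<close> is injective, and \<open>elem_of\<close> inverts it on its range; it is
  used below only for multipliers which lie in the algebra.
\<close>

definition elem_of :: "'a::complex_algebra multiplier \<Rightarrow> 'a" where
  "elem_of m = (THE x. mult_of x = m)"

lift_definition mult_tensor ::
    "'a::complex_algebra multiplier \<Rightarrow> 'b::complex_algebra multiplier \<Rightarrow> ('a, 'b) tensor multiplier"
    (infixl "\<otimes>\<^sub>M" 70)
  is "\<lambda>m n. (tensor_map (fst m) (fst n), tensor_map (snd m) (snd n))"
proof -
  fix m :: "('a \<Rightarrow> 'a) \<times> ('a \<Rightarrow> 'a)" and n :: "('b \<Rightarrow> 'b) \<times> ('b \<Rightarrow> 'b)"
  obtain L R L' R' where mn: "m = (L, R)" "n = (L', R')" by (metis surj_pair)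
  assume "is_multiplier m"
    and "is_multiplier n"
  then have lin: "clinear L" "clinear L'" "clinear R" "clinear R'"
    and m: "\<And>x y. L (x * y) = L x * y" "\<And>x y. R (x * y) = x * R y" "\<And>x y. x * L y = R x * y"
    and n: "\<And>x y. L' (x * y) = L' x * y" "\<And>x y. R' (x * y) = x * R' y" "\<And>x y. x * L' y = R' x * y"
    unfolding mn is_multiplier_def by auto
  let ?L = "tensor_map L L'" and ?R = "tensor_map R R'"
  have linL: "clinear ?L" and linR: "clinear ?R" by (simp_all add: clinear_tensor_map lin)
  note add = linL[unfolded clinear_iff, THEN conjunct1, rule_format]
    linR[unfolded clinear_iff, THEN conjunct1, rule_format]
  note pure = tensor_map_pure[OF lin(1,2)] tensor_map_pure[OF lin(3,4)]
  have "?L (s * t) = ?L s * t" for s t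
    by (induction s t rule: tensor_induct_pair) (simp_all add: mult_pure_tensor pure m n add algebra_simps)
  moreover have "?R (s * t) = s * ?R t" for s t
    by (induction s t rule: tensor_induct_pair) (simp_all add: mult_pure_tensor pure m n add algebra_simps)
  moreover have "s * ?L t = ?R s * t" for s t
    by (induction s t rule: tensor_induct_pair) (simp_all add: mult_pure_tensor pure m n add algebra_simps)
  ultimately show "is_multiplier (tensor_map (fst m) (fst n), tensor_map (snd m) (snd n))"
    using linL linR unfolding mn is_multiplier_def by simp
qed

lemma tensor_flip_mult: "tensor_flip (s * t) = tensor_flip s * tensor_flip t"
  by (induction s t rule: tensor_induct_pair)
    (simp_all add: mult_pure_tensor algebra_simps)

lemma tensor_assoc_mult:
  "tensor_assoc (s * t) = tensor_assoc s * tensor_assoc t"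
proof (induction s t rule: tensor_induct_pair)
  case (pure s z s' z')
  show ?case
    by (induction s s' rule: tensor_induct_pair)
      (simp_all add: mult_pure_tensor pure_tensor_simps algebra_simps)
qed (simp_all add: algebra_simps)

lemma tensor_assoc_inv_mult:
  "tensor_assoc_inv (s * t) = tensor_assoc_inv s * tensor_assoc_inv t"
  by (metis tensor_assoc_inverse tensor_assoc_inv_inverse tensor_assoc_mult)

lift_definition mult_flip ::
    "('a::complex_algebra, 'b::complex_algebra) tensor multiplier \<Rightarrow> ('b, 'a) tensor multiplier"
  is "\<lambda>m. (\<lambda>t. tensor_flip (fst m (tensor_flip t)), \<lambda>t. tensor_flip (snd m (tensor_flip t)))"
  unfolding is_multiplier_iff fst_conv snd_conv
  by (simp add: tensor_flip_mult) (metis tensor_flip_flip tensor_flip_mult)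

lift_definition mult_assoc ::
    "(('a::complex_algebra, 'b::complex_algebra) tensor, 'c::complex_algebra) tensor multiplier \<Rightarrow>
      ('a, ('b, 'c) tensor) tensor multiplier"
  is "\<lambda>m. (\<lambda>t. tensor_assoc (fst m (tensor_assoc_inv t)), \<lambda>t. tensor_assoc (snd m (tensor_assoc_inv t)))"
  unfolding is_multiplier_iff fst_conv snd_conv
  by (simp add: tensor_assoc_mult tensor_assoc_inv_mult) (metis tensor_assoc_inv_inverse tensor_assoc_mult)


section \<open>Regular multiplier Hopf algebras and algebraic quantum groups\<close>

type_synonym 'a coproduct = "'a \<Rightarrow> ('a, 'a) tensor multiplier"

definition canonical_map_1 :: "'a::nondegenerate_algebra coproduct \<Rightarrow> ('a, 'a) tensor \<Rightarrow> ('a, 'a) tensor" where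
  "canonical_map_1 \<Delta> = tensor_lift (\<lambda>a a'. elem_of (\<Delta> a * (1 \<otimes>\<^sub>M mult_of a')))"

definition canonical_map_2 :: "'a::nondegenerate_algebra coproduct \<Rightarrow> ('a, 'a) tensor \<Rightarrow> ('a, 'a) tensor" where
  "canonical_map_2 \<Delta> = tensor_lift (\<lambda>a a'. elem_of ((mult_of a \<otimes>\<^sub>M 1) * \<Delta> a'))"

definition coproduct_left ::
    "'a::nondegenerate_algebra coproduct \<Rightarrow> ('a, 'a) tensor \<Rightarrow> (('a, 'a) tensor, 'a) tensor multiplier" where
  "coproduct_left \<Delta> = tensor_lift (\<lambda>x y. \<Delta> x \<otimes>\<^sub>M mult_of y)"

definition coproduct_right ::
    "'a::nondegenerate_algebra coproduct \<Rightarrow> ('a, 'a) tensor \<Rightarrow> ('a, ('a, 'a) tensor) tensor multiplier" where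
  "coproduct_right \<Delta> = tensor_lift (\<lambda>x y. mult_of x \<otimes>\<^sub>M \<Delta> y)"

definition coassociative :: "'a::nondegenerate_algebra coproduct \<Rightarrow> bool" where
  "coassociative \<Delta> \<longleftrightarrow>
    (\<forall>a c a'.
      mult_assoc ((mult_of a \<otimes>\<^sub>M 1 \<otimes>\<^sub>M 1) * coproduct_left \<Delta> (elem_of (\<Delta> c * (1 \<otimes>\<^sub>M mult_of a')))) =
      coproduct_right \<Delta> (elem_of ((mult_of a \<otimes>\<^sub>M 1) * \<Delta> c)) * (1 \<otimes>\<^sub>M (1 \<otimes>\<^sub>M mult_of a')))"

definition regular_multiplier_hopf_algebra :: "'a::nondegenerate_algebra coproduct \<Rightarrow> bool" where
  "regular_multiplier_hopf_algebra \<Delta> \<longleftrightarrow>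
    clinear \<Delta> \<and> (\<forall>a a'. \<Delta> (a * a') = \<Delta> a * \<Delta> a') \<and>
    (\<forall>a a'. \<Delta> a * (1 \<otimes>\<^sub>M mult_of a') \<in> range mult_of) \<and>
    (\<forall>a a'. (mult_of a \<otimes>\<^sub>M 1) * \<Delta> a' \<in> range mult_of) \<and>
    (\<forall>a a'. \<Delta> a * (mult_of a' \<otimes>\<^sub>M 1) \<in> range mult_of) \<and>
    (\<forall>a a'. (1 \<otimes>\<^sub>M mult_of a) * \<Delta> a' \<in> range mult_of) \<and>
    coassociative \<Delta> \<and>
    bij (canonical_map_1 \<Delta>) \<and> bij (canonical_map_2 \<Delta>) \<and>
    bij (canonical_map_1 (\<lambda>a. mult_flip (\<Delta> a))) \<and> bij (canonical_map_2 (\<lambda>a. mult_flip (\<Delta> a)))"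

definition slice_left :: "('a::complex_vector \<Rightarrow> complex) \<Rightarrow> ('a, 'b::complex_vector) tensor \<Rightarrow> 'b" where
  "slice_left f = tensor_lift (\<lambda>x y. f x *\<^sub>C y)"

definition slice_right :: "('b::complex_vector \<Rightarrow> complex) \<Rightarrow> ('a::complex_vector, 'b) tensor \<Rightarrow> 'a" where
  "slice_right f = tensor_lift (\<lambda>x y. f y *\<^sub>C x)"

text \<open>
  The element \<open>(\<iota> \<otimes> \<phi>)\<Delta>(a)\<close> of \<open>M(A)\<close> acts on \<open>x\<close> from the left as
  \<open>(\<iota> \<otimes> \<phi>)(\<Delta>(a)(x \<otimes> 1))\<close> and from the right as \<open>(\<iota> \<otimes> \<phi>)((x \<otimes> 1)\<Delta>(a))\<close>; the equality
  \<open>(\<iota> \<otimes> \<phi>)\<Delta>(a) = \<phi>(a) 1\<close> in \<open>M(A)\<close> means that both agree with \<open>\<phi>(a) x\<close>.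
\<close>

definition left_integral :: "'a::nondegenerate_algebra coproduct \<Rightarrow> ('a \<Rightarrow> complex) \<Rightarrow> bool" where
  "left_integral \<Delta> \<phi> \<longleftrightarrow> clinear \<phi> \<and> \<phi> \<noteq> (\<lambda>a. 0) \<and>
    (\<forall>a x. slice_right \<phi> (elem_of (\<Delta> a * (mult_of x \<otimes>\<^sub>M 1))) = \<phi> a *\<^sub>C x \<and>
           slice_right \<phi> (elem_of ((mult_of x \<otimes>\<^sub>M 1) * \<Delta> a)) = \<phi> a *\<^sub>C x)"

definition right_integral :: "'a::nondegenerate_algebra coproduct \<Rightarrow> ('a \<Rightarrow> complex) \<Rightarrow> bool" where
  "right_integral \<Delta> \<psi> \<longleftrightarrow> clinear \<psi> \<and> \<psi> \<noteq> (\<lambda>a. 0) \<and>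
    (\<forall>a x. slice_left \<psi> (elem_of (\<Delta> a * (1 \<otimes>\<^sub>M mult_of x))) = \<psi> a *\<^sub>C x \<and>
           slice_left \<psi> (elem_of ((1 \<otimes>\<^sub>M mult_of x) * \<Delta> a)) = \<psi> a *\<^sub>C x)"

definition algebraic_quantum_group :: "'a::nondegenerate_algebra coproduct \<Rightarrow> bool" where
  "algebraic_quantum_group \<Delta> \<longleftrightarrow> regular_multiplier_hopf_algebra \<Delta> \<and>
    (\<exists>\<phi>. left_integral \<Delta> \<phi>) \<and> (\<exists>\<psi>. right_integral \<Delta> \<psi>)"

definition is_counit :: "'a::nondegenerate_algebra coproduct \<Rightarrow> ('a \<Rightarrow> complex) \<Rightarrow> bool" where
  "is_counit \<Delta> \<epsilon> \<longleftrightarrow> clinear \<epsilon> \<and> (\<forall>a a'. \<epsilon> (a * a') = \<epsilon> a * \<epsilon> a') \<and>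
    (\<forall>a a'. slice_left \<epsilon> (elem_of (\<Delta> a * (1 \<otimes>\<^sub>M mult_of a'))) = a * a') \<and>
    (\<forall>a a'. slice_right \<epsilon> (elem_of ((mult_of a \<otimes>\<^sub>M 1) * \<Delta> a')) = a * a')"

definition is_antipode :: "'a::nondegenerate_algebra coproduct \<Rightarrow> ('a \<Rightarrow> 'a) \<Rightarrow> bool" where
  "is_antipode \<Delta> S \<longleftrightarrow> clinear S \<and> bij S \<and> (\<forall>a a'. S (a * a') = S a' * S a) \<and>
    (\<exists>\<epsilon>. is_counit \<Delta> \<epsilon> \<and>
      (\<forall>a a'. tensor_lift (\<lambda>x y. S x * y) (elem_of (\<Delta> a * (1 \<otimes>\<^sub>M mult_of a'))) = \<epsilon> a *\<^sub>C a') \<and>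
      (\<forall>a a'. tensor_lift (\<lambda>x y. x * S y) (elem_of ((mult_of a \<otimes>\<^sub>M 1) * \<Delta> a')) = \<epsilon> a' *\<^sub>C a))"


section \<open>The dual\<close>

definition tensor_pairing ::
    "('a::complex_vector \<Rightarrow> 'c::complex_vector \<Rightarrow> complex) \<Rightarrow>
     ('b::complex_vector \<Rightarrow> 'd::complex_vector \<Rightarrow> complex) \<Rightarrow>
     ('a, 'b) tensor \<Rightarrow> ('c, 'd) tensor \<Rightarrow> complex" where
  "tensor_pairing p q s t = tensor_lift (\<lambda>x y. tensor_lift (\<lambda>z w. p x z * q y w) t) s"

text \<open>
  The dual depends on the term \<open>\<phi>\<close>, so it enters as a type \<open>'b\<close> which the
  pairing \<open>p a b = \<langle>a, b\<rangle>\<close> identifies linearly and bijectively with the space of functionals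
  \<open>\<phi>(\<cdot> c)\<close>; the pairing determines its vector space structure, its product and its coproduct.
  In the formula for the product, \<open>b \<otimes> b'\<close> with \<open>b = \<phi>(\<cdot> c)\<close> and \<open>b' = \<phi>(\<cdot> c')\<close> is evaluated
  on the multiplier \<open>\<Delta>(a)\<close> as \<open>(\<phi> \<otimes> \<phi>)(\<Delta>(a)(c \<otimes> c'))\<close>.
\<close>

definition is_dual ::
    "'a::nondegenerate_algebra coproduct \<Rightarrow> ('a \<Rightarrow> complex) \<Rightarrow> ('a \<Rightarrow> 'b \<Rightarrow> complex) \<Rightarrow>
      'b::nondegenerate_algebra coproduct \<Rightarrow> bool" where
  "is_dual \<Delta> \<phi> p \<Delta>' \<longleftrightarrow>
    cbilinear p \<and>
    bij_betw (\<lambda>b a. p a b) UNIV {(\<lambda>a. \<phi> (a * c)) | c. True} \<and>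
    (\<forall>a b b' c c'. (\<forall>x. p x b = \<phi> (x * c)) \<longrightarrow> (\<forall>x. p x b' = \<phi> (x * c')) \<longrightarrow>
      p a (b * b') = tensor_lift (\<lambda>x y. \<phi> x * \<phi> y) (lmul (\<Delta> a) (c \<otimes> c'))) \<and>
    (\<forall>b b'. \<exists>t. (mult_of b' \<otimes>\<^sub>M 1) * \<Delta>' b = mult_of t \<and>
      (\<forall>a a'. tensor_pairing p p (a \<otimes> a') t =
        tensor_pairing p p (elem_of (\<Delta> a * (1 \<otimes>\<^sub>M mult_of a'))) (b' \<otimes> b))) \<and>
    (\<forall>b b'. \<exists>t. \<Delta>' b * (1 \<otimes>\<^sub>M mult_of b') = mult_of t \<and>
      (\<forall>a a'. tensor_pairing p p (a \<otimes> a') t =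
        tensor_pairing p p (elem_of ((mult_of a \<otimes>\<^sub>M 1) * \<Delta> a')) (b \<otimes> b')))"

definition act_on_dual :: "('a::complex_algebra \<Rightarrow> 'b \<Rightarrow> complex) \<Rightarrow> 'a \<Rightarrow> 'b \<Rightarrow> 'b" where
  "act_on_dual p a b = (THE b'. \<forall>a'. p a' b' = p (a' * a) b)"

definition act_by_dual :: "('a \<Rightarrow> 'b::complex_algebra \<Rightarrow> complex) \<Rightarrow> 'b \<Rightarrow> 'a \<Rightarrow> 'a" where
  "act_by_dual p b a = (THE a'. \<forall>b'. p a' b' = p a (b' * b))"

text \<open>
  The functional \<open>u \<mapsto> \<langle>m, u\<rangle>\<close> on \<open>A \<otimes> B\<close> of a multiplier \<open>m\<close> of \<open>B \<otimes> A\<close>. It is determined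
  by the stated property since \<open>A\<close> is spanned by the elements \<open>b \<triangleright> a'\<close> and \<open>B\<close> by the elements
  \<open>a \<triangleright> b'\<close>.
\<close>

definition multiplier_pairing ::
    "('a::complex_algebra \<Rightarrow> 'b::complex_algebra \<Rightarrow> complex) \<Rightarrow> ('b, 'a) tensor multiplier \<Rightarrow>
      ('a, 'b) tensor \<Rightarrow> complex" where
  "multiplier_pairing p m = (THE F. clinear F \<and>
    (\<forall>a b a' b'. F (act_by_dual p b a' \<otimes> act_on_dual p a b') =
      tensor_pairing (\<lambda>b a. p a b) p (lmul m (b \<otimes> a)) (a' \<otimes> b')))"

end

theory Submission
  imports Defs
begin

text \<open>
  Let \<open>b \<triangleright> x = (\<iota> \<otimes> b)\<Delta>(x)\<close> and \<open>x \<triangleleft> b = (b \<otimes> \<iota>)\<Delta>(x)\<close> denote the actions of the dual \<open>B\<close> on \<open>A\<close>, and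
  let \<open>F(c) = \<phi>(\<cdot> c)\<close>, so that \<open>F\<close> maps \<open>A\<close> onto \<open>B\<close>. Evaluating the first leg at \<open>x \<in> A\<close> turns an
  element of \<open>B \<otimes> A\<close> into a linear map \<open>A \<rightarrow> A\<close>, and determines it. In this picture \<open>V\<close> has to be
  the identity map: a multiplier \<open>W\<close> with \<open>\<langle>W, a \<otimes> b\<rangle> = \<langle>\<sigma>(a), b\<rangle>\<close> for a linear map \<open>\<sigma>\<close> must satisfy
  \<open>W(b \<otimes> a) = (x \<mapsto> \<sigma>(b \<triangleright> x) a)\<close> and \<open>(b \<otimes> a)W = (x \<mapsto> a \<sigma>(x \<triangleleft> b))\<close>.
  Since the two actions commute, these formulas do define a multiplier as soon as the maps on the
  right come from elements of \<open>B \<otimes> A\<close> (lemma \<open>multiplier_of_linear_map\<close>).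

  That they do, for \<open>\<sigma> = \<iota>\<close> and for \<open>\<sigma> = S\<close>, is the strong form of invariance
  \<open>S((\<iota> \<otimes> \<phi>)(\<Delta>(x)(1 \<otimes> c))) = (\<iota> \<otimes> \<phi>)((1 \<otimes> x)\<Delta>(c))\<close>. Its left side is \<open>S(F(c) \<triangleright> x)\<close>, and its right
  side, multiplied by an element of \<open>A\<close>, has the form \<open>\<Sum> \<phi>(x q\<^sub>i) p\<^sub>i\<close> with a fixed tensor
  \<open>\<Sum> p\<^sub>i \<otimes> q\<^sub>i\<close>; as a map of \<open>x\<close> it is therefore given by \<open>\<Sum> F(q\<^sub>i) \<otimes> p\<^sub>i \<in> B \<otimes> A\<close>.
  For \<open>\<sigma> = \<iota>\<close> the inverse of \<open>S\<close> is applied afterwards. The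
  multiplication from the right is treated in the same way with a right integral \<open>\<psi>\<close>, because the
  functionals \<open>\<psi>(\<cdot> c)\<close> fill the same space \<open>B\<close>
  (lemmas \<open>strong_left_invariance\<close>, \<open>strong_right_invariance\<close>, \<open>left_right_integral_exchange\<close>).

  The multiplier of \<open>\<sigma> = \<iota>\<close> is \<open>V\<close>, and the one of \<open>\<sigma> = S\<close> is \<open>(S \<otimes> \<iota>)V\<close>. It is also \<open>(\<iota> \<otimes> S)V\<close>, since the
  antipode of \<open>B\<close> is the transpose of the antipode of \<open>A\<close> (lemma \<open>antipode_dual\<close>).

  For uniqueness, the pairing of a multiplier with \<open>A \<otimes> B\<close> determines it, provided that this pairing is
  well defined. It is, because the left \<open>B \<otimes> A\<close>-module \<open>A \<otimes> B\<close> is isomorphic to \<open>B \<otimes> A\<close>: identifying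
  \<open>x \<otimes> F(c)\<close> with \<open>F(S(x)) \<otimes> c\<close>, the pairing with \<open>m\<close> becomes \<open>t \<mapsto> (h \<otimes> \<phi>)(m t)\<close> with the
  functional \<open>h(F(c)) = \<epsilon>(c)\<close> on \<open>B\<close> (lemma \<open>multiplier_pairing_actions\<close>). This identification, and the
  uniqueness of the actions, rest on the faithfulness of \<open>\<phi>\<close>.
\<close>


section \<open>Linear maps on tensor products\<close>

lemma clinear_id [simp]: "clinear (\<lambda>x. x)"
  by (simp add: clinear_iff)

lemma clinear_zero [simp]: "clinear (\<lambda>x. 0)"
  by (simp add: clinear_iff complex_vector.scale_zero_right)

lemma clinear_compose: "clinear f \<Longrightarrow> clinear g \<Longrightarrow> clinear (\<lambda>x. f (g x))"
  by (simp add: clinear_iff)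

lemma clinear_inv:
  assumes "clinear f" "bij f"
  shows "clinear (inv f)"
proof -
  have "inv f (x + y) = inv f x + inv f y" for x y
    by (rule injD[OF bij_is_inj[OF assms(2)]])
      (simp add: clinear_add[OF assms(1)] surj_f_inv_f[OF bij_is_surj[OF assms(2)]])
  moreover have "inv f (c *\<^sub>C x) = c *\<^sub>C inv f x" for c x
    by (rule injD[OF bij_is_inj[OF assms(2)]])
      (simp add: clinear_scale[OF assms(1)] surj_f_inv_f[OF bij_is_surj[OF assms(2)]])
  ultimately show ?thesis by (simp add: clinear_iff)
qed

lemma scaleC_complex [simp]: "c *\<^sub>C (x::complex) = c * x"
  by (simp add: scaleC_complex_def)

lemma pure_tensor_zero [simp]: "0 \<otimes> y = 0" "x \<otimes> 0 = 0"
  using pure_tensor_simps(3)[of 0 0 y] pure_tensor_simps(4)[of x 0 0] by simp_all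

lemma clinear_pure_tensor: "clinear (\<lambda>x. x \<otimes> y)" "clinear (\<lambda>y. x \<otimes> y)"
  by (simp_all add: clinear_iff pure_tensor_simps)

lemma clinear_eq_on_tensors:
  assumes "clinear f" "clinear g" "\<And>x y. f (x \<otimes> y) = g (x \<otimes> y)"
  shows "f t = g t"
  by (induction t rule: tensor_induct) (simp_all add: assms clinear_add[of f] clinear_add[of g])

lemma cbilinear_scale_left: "clinear f \<Longrightarrow> cbilinear (\<lambda>x y. f x *\<^sub>C y)"
  by (simp add: cbilinear_iff clinear_iff scaleC_add_left scaleC_add_right mult.commute)

lemma cbilinear_scale_right: "clinear f \<Longrightarrow> cbilinear (\<lambda>x y. f y *\<^sub>C x)"
  by (simp add: cbilinear_iff clinear_iff scaleC_add_left scaleC_add_right mult.commute)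

lemma slice_left_pure: "clinear f \<Longrightarrow> slice_left f (x \<otimes> y) = f x *\<^sub>C y"
  by (simp add: slice_left_def tensor_lift_pure cbilinear_scale_left)

lemma slice_right_pure: "clinear f \<Longrightarrow> slice_right f (x \<otimes> y) = f y *\<^sub>C x"
  by (simp add: slice_right_def tensor_lift_pure cbilinear_scale_right)

lemma clinear_slice_left: "clinear f \<Longrightarrow> clinear (slice_left f)"
  by (simp add: slice_left_def clinear_tensor_lift cbilinear_scale_left)

lemma clinear_slice_right: "clinear f \<Longrightarrow> clinear (slice_right f)"
  by (simp add: slice_right_def clinear_tensor_lift cbilinear_scale_right)

lemma slice_right_zero: "slice_right (\<lambda>_. 0) t = 0"
  by (simp add: slice_right_def tensor_lift_def free_lift_def case_prod_unfold)

lemma cbilinear_compose: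
  "cbilinear k \<Longrightarrow> clinear f \<Longrightarrow> clinear g \<Longrightarrow> cbilinear (\<lambda>x y. k (f x) (g y))"
  by (simp add: cbilinear_iff clinear_iff)

lemma clinear_cbilinear: "clinear h \<Longrightarrow> cbilinear k \<Longrightarrow> cbilinear (\<lambda>x y. h (k x y))"
  by (simp add: cbilinear_iff clinear_iff)

abbreviation leg1 :: "('a::complex_vector \<Rightarrow> 'c::complex_vector) \<Rightarrow> ('a, 'b::complex_vector) tensor \<Rightarrow> ('c, 'b) tensor" where
  "leg1 f \<equiv> tensor_map f (\<lambda>y. y)"

abbreviation leg2 :: "('b::complex_vector \<Rightarrow> 'c::complex_vector) \<Rightarrow> ('a::complex_vector, 'b) tensor \<Rightarrow> ('a, 'c) tensor" where
  "leg2 g \<equiv> tensor_map (\<lambda>x. x) g"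

lemma tensor_lift_tensor_map:
  assumes "cbilinear k" "clinear f" "clinear g"
  shows "tensor_lift k (tensor_map f g t) = tensor_lift (\<lambda>x y. k (f x) (g y)) t"
  by (rule clinear_eq_on_tensors)
    (simp_all add: assms clinear_compose[OF clinear_tensor_lift clinear_tensor_map] clinear_tensor_lift
      cbilinear_compose tensor_map_pure tensor_lift_pure)

lemma clinear_of_tensor_lift:
  assumes "clinear h" "cbilinear k"
  shows "h (tensor_lift k t) = tensor_lift (\<lambda>x y. h (k x y)) t"
  by (rule clinear_eq_on_tensors)
    (simp_all add: assms clinear_compose[OF assms(1)] clinear_tensor_lift clinear_cbilinear tensor_lift_pure)

lemma slice_left_tensor_map:
  assumes "clinear f" "clinear g" "clinear h"
  shows "slice_left h (tensor_map f g t) = g (slice_left (\<lambda>x. h (f x)) t)"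
  by (rule clinear_eq_on_tensors)
    (simp_all add: assms clinear_compose[OF clinear_slice_left clinear_tensor_map]
      clinear_compose[OF assms(2) clinear_slice_left] clinear_compose[OF assms(3,1)]
      tensor_map_pure slice_left_pure clinear_scale[OF assms(2)])

lemma slice_right_tensor_map:
  assumes "clinear f" "clinear g" "clinear h"
  shows "slice_right h (tensor_map f g t) = f (slice_right (\<lambda>y. h (g y)) t)"
  by (rule clinear_eq_on_tensors)
    (simp_all add: assms clinear_compose[OF clinear_slice_right clinear_tensor_map]
      clinear_compose[OF assms(1) clinear_slice_right] clinear_compose[OF assms(3,2)]
      tensor_map_pure slice_right_pure clinear_scale[OF assms(1)])

lemma tensor_map_tensor_map:
  assumes "clinear f" "clinear g" "clinear f'" "clinear g'"
  shows "tensor_map f g (tensor_map f' g' t) = tensor_map (\<lambda>x. f (f' x)) (\<lambda>y. g (g' y)) t"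
  by (rule clinear_eq_on_tensors)
    (simp_all add: assms clinear_compose[OF clinear_tensor_map clinear_tensor_map]
     clinear_tensor_map clinear_compose[OF assms(1,3)] clinear_compose[OF assms(2,4)] tensor_map_pure)

text \<open>
  The computation \<open>(f \<otimes> g)(t)\<close> in two steps, in either order. Most interchanges of functionals below are
  instances of it.
\<close>

lemma slice_slice:
  assumes "clinear f" "clinear g"
  shows "f (slice_right g t) = g (slice_left f t)"
  by (rule clinear_eq_on_tensors)
    (simp_all add: assms clinear_compose[OF assms(1) clinear_slice_right] clinear_compose[OF assms(2) clinear_slice_left]
      slice_left_pure slice_right_pure clinear_scale[OF assms(1)] clinear_scale[OF assms(2)] mult.commute)

text \<open>
  Expand the first factors in a basis of the first space; the coefficients are the slices by the
  coordinate functionals \<open>e i\<close>. The \<open>i\<close> in the index set \<open>I\<close> are basis vectors.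
\<close>

lemma tensor_basis_expansion:
  fixes t :: "('a::complex_vector, 'b::complex_vector) tensor"
  obtains I :: "'a set" and e :: "'a \<Rightarrow> 'a \<Rightarrow> complex"
  where "finite I" "\<And>i. clinear (e i)" "t = (\<Sum>i\<in>I. i \<otimes> slice_left (e i) t)"
proof -
  define X :: "'a set" where "X = complex_vector.extend_basis {}"
  have indep: "complex_vector.independent X" and sp: "complex_vector.span X = UNIV"
    unfolding X_def by (simp_all add: complex_vector.independent_extend_basis complex_vector.span_extend_basis complex_vector.independent_empty)
  define e where "e i x = complex_vector.representation X x i" for i x
  have lin: "clinear (e i)" for i
    unfolding clinear_iff e_def
    by (simp add: complex_vector.representation_add[OF indep] complex_vector.representation_scale[OF indep] sp)
  note sl = slice_left_pure[OF lin] clinear_slice_left[OF lin]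
  have "\<exists>I. finite I \<and> (\<forall>J. finite J \<longrightarrow> I \<subseteq> J \<longrightarrow> t = (\<Sum>i\<in>J. i \<otimes> slice_left (e i) t))"
  proof (induction t rule: tensor_induct)
    case (pure x y)
    let ?I = "{i. e i x \<noteq> 0}"
    have fin: "finite ?I" unfolding e_def by (rule complex_vector.finite_representation)
    moreover have "x \<otimes> y = (\<Sum>i\<in>J. i \<otimes> slice_left (e i) (x \<otimes> y))" if "finite J" "?I \<subseteq> J" for J
    proof -
      have "x = (\<Sum>i\<in>?I. e i x *\<^sub>C i)"
        unfolding e_def using complex_vector.sum_nonzero_representation_eq[OF indep, of x] sp by simp
      also have "\<dots> = (\<Sum>i\<in>J. e i x *\<^sub>C i)"
        by (rule sum.mono_neutral_left) (use that in auto)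
      finally have x: "x = (\<Sum>i\<in>J. e i x *\<^sub>C i)" .
      have add: "(\<Sum>i\<in>J. f i) \<otimes> y = (\<Sum>i\<in>J. f i \<otimes> y)" for f :: "'a \<Rightarrow> 'a"
        by (induction J rule: infinite_finite_induct) (simp_all add: pure_tensor_simps)
      show ?thesis
        by (subst x, subst add) (simp add: sl pure_tensor_simps)
    qed
    ultimately show ?case by blast
  next
    case (add s t)
    then obtain I J where I: "finite I" "\<forall>K. finite K \<longrightarrow> I \<subseteq> K \<longrightarrow> s = (\<Sum>i\<in>K. i \<otimes> slice_left (e i) s)"
      and J: "finite J" "\<forall>K. finite K \<longrightarrow> J \<subseteq> K \<longrightarrow> t = (\<Sum>i\<in>K. i \<otimes> slice_left (e i) t)"
      by blast
    have "s + t = (\<Sum>i\<in>K. i \<otimes> slice_left (e i) (s + t))" if K: "finite K" "I \<union> J \<subseteq> K" for K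
    proof -
      have s: "(\<Sum>i\<in>K. i \<otimes> slice_left (e i) s) = s" and t: "(\<Sum>i\<in>K. i \<otimes> slice_left (e i) t) = t"
        using I(2) J(2) K by simp_all
      show ?thesis
        by (simp only: clinear_add[OF sl(2)] pure_tensor_simps sum.distrib s t)
    qed
    then show ?case using I(1) J(1) by (intro exI[of _ "I \<union> J"]) simp
  qed
  with lin show thesis by (metis order_refl that)
qed

text \<open>
  The kernel of \<open>\<iota> \<otimes> f\<close>, for all \<open>f\<close> in \<open>K\<close> at once, is \<open>X \<otimes> N\<close> with \<open>N\<close> the common kernel of \<open>K\<close>: in
  a basis expansion of \<open>t\<close> each coefficient lies in \<open>N\<close>. With this, a statement about slices turns into
  one about elements of \<open>N\<close>; it carries both faithfulness proofs and all separation arguments.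
\<close>

lemma slice_right_kernel:
  fixes t :: "('a::complex_vector, 'b::complex_vector) tensor"
  assumes K: "\<And>f. f \<in> K \<Longrightarrow> clinear f" and t: "\<And>f. f \<in> K \<Longrightarrow> slice_right f t = 0"
  shows "t \<in> complex_vector.span {x \<otimes> y | x y. \<forall>f\<in>K. f y = 0}"
proof -
  obtain I :: "'a set" and e where I: "finite I" "\<And>i. clinear (e i)" "t = (\<Sum>i\<in>I. i \<otimes> slice_left (e i) t)"
    using tensor_basis_expansion[of t] by blast
  have "f (slice_left (e i) t) = 0" if "f \<in> K" for f i
    using slice_slice[OF I(2) K[OF that], of i t] t[OF that] clinear_0[OF I(2)] by simp
  then have "i \<otimes> slice_left (e i) t \<in> complex_vector.span {x \<otimes> y | x y. \<forall>f\<in>K. f y = 0}" for i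
    by (intro complex_vector.span_base) blast
  then show ?thesis by (subst I(3)) (rule complex_vector.span_sum)
qed

lemma clinear_zero_on_span:
  assumes "clinear h" "\<And>x. x \<in> X \<Longrightarrow> h x = 0" "x \<in> complex_vector.span X"
  shows "h x = 0"
  using assms(3)
  by (induction rule: complex_vector.span_induct_alt)
    (simp_all add: assms(2) clinear_0[OF assms(1)] clinear_add[OF assms(1)] clinear_scale[OF assms(1)])

lemma slice_right_separates:
  assumes "\<And>f. f \<in> K \<Longrightarrow> clinear f" "\<And>y. (\<And>f. f \<in> K \<Longrightarrow> f y = 0) \<Longrightarrow> y = 0"
    and "\<And>f. f \<in> K \<Longrightarrow> slice_right f t = 0"
  shows "t = 0"
proof (rule clinear_zero_on_span[OF clinear_id])
  show "t \<in> complex_vector.span {x \<otimes> y | x y. \<forall>f\<in>K. f y = 0}"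
    by (rule slice_right_kernel[OF assms(1,3)])
  show "z = 0" if z: "z \<in> {x \<otimes> y | x y. \<forall>f\<in>K. f y = 0}" for z
  proof -
    obtain x y where y: "z = x \<otimes> y" "\<forall>f\<in>K. f y = 0" using z by blast
    then have "y = 0" by (intro assms(2)) simp
    then show "z = 0" by (simp add: y(1))
  qed
qed

lemma slice_left_flip: "clinear f \<Longrightarrow> slice_left f t = slice_right f (tensor_flip t)"
  by (rule clinear_eq_on_tensors)
   (simp_all add: clinear_slice_left clinear_compose[OF clinear_slice_right clinear_tensor_flip] slice_left_pure slice_right_pure)

lemma slice_left_separates:
  assumes "\<And>f. f \<in> K \<Longrightarrow> clinear f" "\<And>y. (\<And>f. f \<in> K \<Longrightarrow> f y = 0) \<Longrightarrow> y = 0"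
    and "\<And>f. f \<in> K \<Longrightarrow> slice_left f t = 0"
  shows "t = 0"
proof -
  have "tensor_flip t = 0"
    by (rule slice_right_separates[of K]) (use assms in \<open>auto simp: slice_left_flip\<close>)
  then show ?thesis using tensor_flip_flip[of t] clinear_0[OF clinear_tensor_flip] by metis
qed

text \<open>
  The basis expansion of \<open>x \<otimes> 1\<close> in \<open>X \<otimes> \<complex>\<close> has the coordinates of \<open>x\<close> as coefficients.
\<close>

lemma functionals_separate:
  fixes x :: "'a::complex_vector"
  assumes "\<And>f :: 'a \<Rightarrow> complex. clinear f \<Longrightarrow> f x = 0"
  shows "x = 0"
proof -
  obtain I :: "'a set" and e where I: "finite I" "\<And>i. clinear (e i)"
      "x \<otimes> (1::complex) = (\<Sum>i\<in>I. i \<otimes> slice_left (e i) (x \<otimes> (1::complex)))"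
    using tensor_basis_expansion[of "x \<otimes> (1::complex)"] by blast
  have "x \<otimes> (1::complex) = 0"
    by (subst I(3)) (simp add: slice_left_pure I(2) assms)
  moreover have "slice_right (\<lambda>z. z) (x \<otimes> (1::complex)) = x"
    by (simp add: slice_right_pure)
  ultimately show ?thesis using clinear_0[OF clinear_slice_right[OF clinear_id]] by metis
qed

section \<open>Non-degenerate algebras and their multipliers\<close>

lemma slice_right_mult_pure:
  assumes "clinear g"
  shows "slice_right g (s * (x \<otimes> y)) = slice_right (\<lambda>v. g (v * y)) s * x"
    and "slice_right g ((x \<otimes> y) * s) = x * slice_right (\<lambda>v. g (y * v)) s"
proof -
  have lin: "clinear (\<lambda>v. g (v * y))" "clinear (\<lambda>v. g (y * v))"
    by (simp_all add: clinear_compose[OF assms] clinear_mult)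
  note sl = clinear_slice_right[OF assms] clinear_slice_right[OF lin(1)] clinear_slice_right[OF lin(2)]
  show "slice_right g (s * (x \<otimes> y)) = slice_right (\<lambda>v. g (v * y)) s * x"
    by (rule clinear_eq_on_tensors)
      (simp_all add: clinear_compose[OF sl(1) clinear_mult(2)] clinear_compose[OF clinear_mult(2) sl(2)]
        slice_right_pure lin assms mult_pure_tensor)
  show "slice_right g ((x \<otimes> y) * s) = x * slice_right (\<lambda>v. g (y * v)) s"
    by (rule clinear_eq_on_tensors)
      (simp_all add: clinear_compose[OF sl(1) clinear_mult(1)] clinear_compose[OF clinear_mult(1) sl(3)]
        slice_right_pure lin assms mult_pure_tensor)
qed

text \<open>
  Slicing by \<open>v \<mapsto> g(v y)\<close> reduces \<open>s (x \<otimes> y) = 0\<close> to a product with \<open>x\<close> in the first algebra, and these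
  functionals separate the points of the second algebra because it is non-degenerate.
\<close>

instance tensor :: (nondegenerate_algebra, nondegenerate_algebra) nondegenerate_algebra
proof
  fix s :: "('a, 'b) tensor"
  define K where "K = {\<lambda>v. g (v * y) | (g :: 'b \<Rightarrow> complex) y. clinear g}"
  define K' where "K' = {\<lambda>v. g (y * v) | (g :: 'b \<Rightarrow> complex) y. clinear g}"
  have lin: "clinear f" if "f \<in> K \<union> K'" for f
    using that clinear_mult[where 'a='b] unfolding K_def K'_def by (auto simp: clinear_iff)
  show "s = 0" if "\<forall>t. s * t = 0"
  proof (rule slice_right_separates)
    show "clinear f" if "f \<in> K" for f using lin that by simp
    show "y = 0" if "\<And>f. f \<in> K \<Longrightarrow> f y = 0" for y
      by (rule nondegenerate_left, intro allI, rule functionals_separate)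
        (use that in \<open>auto simp: K_def\<close>)
    show "slice_right f s = 0" if fK: "f \<in> K" for f
    proof (rule nondegenerate_left, intro allI)
      fix x
      obtain g y where f: "f = (\<lambda>v. g (v * y))" and g: "clinear g"
        using fK unfolding K_def by blast
      show "slice_right f s * x = 0"
        using slice_right_mult_pure(1)[OF g, of s x y, symmetric] \<open>\<forall>t. s * t = 0\<close> clinear_0[OF clinear_slice_right[OF g]]
        by (simp add: f)
    qed
  qed
  show "s = 0" if "\<forall>t. t * s = 0"
  proof (rule slice_right_separates)
    show "clinear f" if "f \<in> K'" for f using lin that by simp
    show "y = 0" if "\<And>f. f \<in> K' \<Longrightarrow> f y = 0" for y
      by (rule nondegenerate_right, intro allI, rule functionals_separate)
        (use that in \<open>auto simp: K'_def\<close>)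
    show "slice_right f s = 0" if fK: "f \<in> K'" for f
    proof (rule nondegenerate_right, intro allI)
      fix x
      obtain g y where f: "f = (\<lambda>v. g (y * v))" and g: "clinear g"
        using fK unfolding K'_def by blast
      show "x * slice_right f s = 0"
        using slice_right_mult_pure(2)[OF g, of x y s, symmetric] \<open>\<forall>t. t * s = 0\<close> clinear_0[OF clinear_slice_right[OF g]]
        by (simp add: f)
    qed
  qed
qed

lemma nondegenerate_eqI:
  fixes x y :: "'a::nondegenerate_algebra"
  shows "(\<And>z. x * z = y * z) \<Longrightarrow> x = y" and "(\<And>z. z * x = z * y) \<Longrightarrow> x = y"
  using nondegenerate_left[of "x - y"] nondegenerate_right[of "x - y"] by (simp_all add: algebra_simps)

lemma lmul_times [simp]: "lmul (m * n) x = lmul m (lmul n x)" by transfer simp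
lemma rmul_times [simp]: "rmul x (m * n) = rmul (rmul x m) n" by transfer simp
lemma lmul_one [simp]: "lmul 1 x = x" by transfer simp
lemma rmul_one [simp]: "rmul x 1 = x" by transfer simp
lemma lmul_mult_of [simp]: "lmul (mult_of a) x = a * x" by transfer simp
lemma rmul_mult_of [simp]: "rmul x (mult_of a) = x * a" by transfer simp

lemma lmul_fun:
  "lmul (m * n) = (\<lambda>x. lmul m (lmul n x))" "lmul 1 = (\<lambda>x. x)" "lmul (mult_of a) = (\<lambda>x. a * x)"
  by auto

lemma lmul_mult_tensor: "lmul (m \<otimes>\<^sub>M n) = tensor_map (lmul m) (lmul n)" by transfer simp
lemma rmul_mult_tensor: "(\<lambda>t. rmul t (m \<otimes>\<^sub>M n)) = tensor_map (\<lambda>x. rmul x m) (\<lambda>y. rmul y n)" by transfer simp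

lemma clinear_lmul: "clinear (lmul m)"
  by transfer (simp add: is_multiplier_iff clinear_iff)
lemma clinear_rmul: "clinear (\<lambda>x. rmul x m)"
  by transfer (simp add: is_multiplier_iff clinear_iff)
lemma lmul_mult: "lmul m (x * y) = lmul m x * y"
  by transfer (simp add: is_multiplier_iff)
lemma mult_lmul: "x * lmul m y = rmul x m * y"
  by transfer (simp add: is_multiplier_iff)
lemma lmul_add_left: "lmul (m + n) x = lmul m x + lmul n x" by transfer simp
lemma lmul_scale_left: "lmul (c *\<^sub>C m) x = c *\<^sub>C lmul m x" by transfer simp

lemma mult_of_inject [simp]: "mult_of x = mult_of y \<longleftrightarrow> x = y" for x y :: "'a::nondegenerate_algebra"
  by (metis lmul_mult_of nondegenerate_eqI(1))

lemma elem_of_mult_of [simp]: "elem_of (mult_of x) = x" for x :: "'a::nondegenerate_algebra"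
  by (simp add: elem_of_def)

lemma mult_of_elem_of: "m \<in> range mult_of \<Longrightarrow> mult_of (elem_of m) = m"
  for m :: "'a::nondegenerate_algebra multiplier"
  by auto

text \<open>
  By \<open>x (m y) = (x m) y\<close> and non-degeneracy, the left half of a multiplier determines the right half.
\<close>

lemma multiplier_eq_of_lmul:
  fixes m n :: "'a::nondegenerate_algebra multiplier"
  assumes "\<And>x. lmul m x = lmul n x"
  shows "m = n"
  by (rule multiplier_eqI[OF assms], rule nondegenerate_eqI(1)) (metis assms mult_lmul)

lemma mult_of_times_multiplier:
  "mult_of x * m = mult_of (rmul x m)" "m * mult_of x = mult_of (lmul m x)"
  for x :: "'a::nondegenerate_algebra"
  by (rule multiplier_eq_of_lmul, simp add: lmul_mult mult_lmul)+

lemma clinear_mult_of: "clinear mult_of"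
  by (auto simp: clinear_iff algebra_simps intro!: multiplier_eqI) (transfer; simp add: algebra_simps)+

lemma mult_tensor_mult_of: "mult_of x \<otimes>\<^sub>M mult_of y = mult_of (x \<otimes> y)"
  for x :: "'a::nondegenerate_algebra" and y :: "'b::nondegenerate_algebra"
proof (rule multiplier_eq_of_lmul)
  fix t
  show "lmul (mult_of x \<otimes>\<^sub>M mult_of y) t = lmul (mult_of (x \<otimes> y)) t"
    unfolding lmul_mult_tensor lmul_mult_of
    by (rule clinear_eq_on_tensors) (simp_all add: clinear_tensor_map clinear_lmul clinear_mult mult_pure_tensor tensor_map_pure)
qed

lemma mult_tensor_times: "(m \<otimes>\<^sub>M n) * (m' \<otimes>\<^sub>M n') = (m * m') \<otimes>\<^sub>M (n * n')"
  for m m' :: "'a::nondegenerate_algebra multiplier" and n n' :: "'b::nondegenerate_algebra multiplier"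
  by (rule multiplier_eq_of_lmul)
    (simp add: lmul_mult_tensor tensor_map_tensor_map clinear_lmul lmul_fun)

lemma cbilinear_mult_tensor:
  "cbilinear (\<lambda>(m::'a::nondegenerate_algebra multiplier) (n::'b::nondegenerate_algebra multiplier). m \<otimes>\<^sub>M n)"
proof -
  have eq: "m = n" if "\<And>x y. lmul m (x \<otimes> y) = lmul n (x \<otimes> y)" for m n :: "('a, 'b) tensor multiplier"
    by (rule multiplier_eq_of_lmul, rule clinear_eq_on_tensors) (simp_all add: that clinear_lmul)
  have pure: "lmul (m \<otimes>\<^sub>M n) (x \<otimes> y) = lmul m x \<otimes> lmul n y"
    for m :: "'a multiplier" and n :: "'b multiplier" and x y
    by (simp add: lmul_mult_tensor tensor_map_pure clinear_lmul)
  show ?thesis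
    unfolding cbilinear_iff
    by (intro conjI allI; rule eq)
      (simp_all add: pure lmul_add_left lmul_scale_left pure_tensor_simps)
qed

lemma mult_assoc_mult_of: "mult_assoc (mult_of s) = mult_of (tensor_assoc s)"
  by (rule multiplier_eqI; transfer) (simp_all add: tensor_assoc_mult)

section \<open>Coproducts with one leg covered\<close>

lemma lmul_leg: "lmul (mult_of x \<otimes>\<^sub>M 1) = leg1 (\<lambda>u. x * u)" "lmul (1 \<otimes>\<^sub>M mult_of y) = leg2 (\<lambda>v. y * v)"
  by (simp_all add: lmul_mult_tensor lmul_fun)

lemma rmul_leg: "rmul t (mult_of x \<otimes>\<^sub>M 1) = leg1 (\<lambda>u. u * x) t" "rmul t (1 \<otimes>\<^sub>M mult_of y) = leg2 (\<lambda>v. v * y) t"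
  using fun_cong[OF rmul_mult_tensor, of t "mult_of x" 1] fun_cong[OF rmul_mult_tensor, of t 1 "mult_of y"]
  by simp_all

lemma mult_of_legs:
  fixes x :: "'a::nondegenerate_algebra" and y :: "'b::nondegenerate_algebra"
  shows "(mult_of x \<otimes>\<^sub>M 1) * (1 \<otimes>\<^sub>M mult_of y) = mult_of (x \<otimes> y)"
    and "(1 \<otimes>\<^sub>M mult_of y) * (mult_of x \<otimes>\<^sub>M 1) = mult_of (x \<otimes> y)"
  by (simp_all add: mult_tensor_times mult_tensor_mult_of)

lemma clinear_scaleC_left: "clinear f \<Longrightarrow> clinear (\<lambda>x. f x *\<^sub>C u)"
  by (simp add: clinear_iff scaleC_add_left)

lemma leg1_scaleC: "clinear f \<Longrightarrow> leg1 (\<lambda>g. f g *\<^sub>C u) t = u \<otimes> slice_left f t"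
  by (rule clinear_eq_on_tensors)
    (simp_all add: tensor_map_pure slice_left_pure pure_tensor_simps clinear_scaleC_left
      clinear_tensor_map clinear_compose[OF clinear_pure_tensor(2) clinear_slice_left])

lemma leg2_scaleC: "clinear f \<Longrightarrow> leg2 (\<lambda>g. f g *\<^sub>C u) t = slice_right f t \<otimes> u"
  by (rule clinear_eq_on_tensors)
    (simp_all add: tensor_map_pure slice_right_pure pure_tensor_simps clinear_scaleC_left
      clinear_tensor_map clinear_compose[OF clinear_pure_tensor(1) clinear_slice_right])

lemma mult_tensor_simps:
  fixes m m' :: "'a::nondegenerate_algebra multiplier" and n n' :: "'b::nondegenerate_algebra multiplier"
  shows "(m + m') \<otimes>\<^sub>M n = m \<otimes>\<^sub>M n + m' \<otimes>\<^sub>M n" "m \<otimes>\<^sub>M (n + n') = m \<otimes>\<^sub>M n + m \<otimes>\<^sub>M n'"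
    "(c *\<^sub>C m) \<otimes>\<^sub>M n = c *\<^sub>C (m \<otimes>\<^sub>M n)" "m \<otimes>\<^sub>M (c *\<^sub>C n) = c *\<^sub>C (m \<otimes>\<^sub>M n)"
  using cbilinear_mult_tensor[where 'a='a and 'b='b] unfolding cbilinear_iff by blast+

lemma mult_of_simps: "mult_of (x + y) = mult_of x + mult_of y" "mult_of (c *\<^sub>C x) = c *\<^sub>C mult_of x"
  using clinear_mult_of unfolding clinear_iff by blast+

text \<open>
  This lemma and its mirror image evaluate, on elementary tensors, the formulas for the inverses of the canonical
  maps given below.
\<close>

lemma leg1_lift_assoc: 
  assumes "cbilinear k"
  shows "leg1 (tensor_lift k) (tensor_assoc_inv (a \<otimes> t)) = leg1 (k a) t"
proof (rule clinear_eq_on_tensors[where t = t])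
  have k: "clinear (k a)" using assms by (simp add: cbilinear_def)
  show "clinear (leg1 (k a))" by (simp add: clinear_tensor_map k)
  show "clinear (\<lambda>t. leg1 (tensor_lift k) (tensor_assoc_inv (a \<otimes> t)))"
    by (intro clinear_compose[OF clinear_tensor_map] clinear_compose[OF clinear_tensor_assoc_inv]
        clinear_tensor_lift clinear_pure_tensor assms clinear_id)
  show "leg1 (tensor_lift k) (tensor_assoc_inv (a \<otimes> (x \<otimes> y))) = leg1 (k a) (x \<otimes> y)" for x y
    by (simp add: tensor_map_pure clinear_tensor_lift assms k tensor_lift_pure)
qed

lemma leg2_lift_assoc: 
  assumes "cbilinear k"
  shows "leg2 (tensor_lift k) (tensor_assoc (t \<otimes> a)) = leg2 (\<lambda>q. k q a) t"
proof (rule clinear_eq_on_tensors[where t = t])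
  have k: "clinear (\<lambda>q. k q a)" using assms by (simp add: cbilinear_def)
  show "clinear (leg2 (\<lambda>q. k q a))" by (simp add: clinear_tensor_map k)
  show "clinear (\<lambda>t. leg2 (tensor_lift k) (tensor_assoc (t \<otimes> a)))"
    by (intro clinear_compose[OF clinear_tensor_map] clinear_compose[OF clinear_tensor_assoc]
        clinear_tensor_lift clinear_pure_tensor assms clinear_id)
  show "leg2 (tensor_lift k) (tensor_assoc ((x \<otimes> y) \<otimes> a)) = leg2 (\<lambda>q. k q a) (x \<otimes> y)" for x y
    by (simp add: tensor_map_pure clinear_tensor_lift assms k tensor_lift_pure)
qed

lemma mult_flip_times: "mult_flip (m * n) = mult_flip m * mult_flip n"
  by transfer simp

lemma mult_flip_mult_of: "mult_flip (mult_of s) = mult_of (tensor_flip s)"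
  by transfer (simp add: tensor_flip_mult)

lemma mult_flip_tensor: "mult_flip (m \<otimes>\<^sub>M n) = n \<otimes>\<^sub>M m"
  for m :: "'a::nondegenerate_algebra multiplier" and n :: "'b::nondegenerate_algebra multiplier"
proof (rule multiplier_eq_of_lmul)
  fix t
  have "lmul (mult_flip k) t = tensor_flip (lmul k (tensor_flip t))" for k :: "('a, 'b) tensor multiplier"
    by transfer simp
  then have "lmul (mult_flip (m \<otimes>\<^sub>M n)) t = tensor_flip (tensor_map (lmul m) (lmul n) (tensor_flip t))"
    by (simp add: lmul_mult_tensor)
  also have "\<dots> = tensor_map (lmul n) (lmul m) t"
    by (rule clinear_eq_on_tensors)
      (auto intro!: clinear_compose[OF clinear_tensor_flip] clinear_compose[OF clinear_tensor_map]
        clinear_tensor_flip clinear_tensor_map clinear_lmul simp: tensor_map_pure clinear_lmul)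
  finally show "lmul (mult_flip (m \<otimes>\<^sub>M n)) t = lmul (n \<otimes>\<^sub>M m) t"
    by (simp add: lmul_mult_tensor)
qed

text \<open>
  The antipode axioms hold for a particular counit, so the two are fixed together.
\<close>

locale multiplier_hopf =
  fixes \<Delta> :: "'a::nondegenerate_algebra coproduct" and S :: "'a \<Rightarrow> 'a" and \<epsilon> :: "'a \<Rightarrow> complex"
  assumes regular: "regular_multiplier_hopf_algebra \<Delta>"
    and clinear_S: "clinear S" and bij_S: "bij S" and S_mult: "S (a * a') = S a' * S a"
    and clinear_counit: "clinear \<epsilon>"
    and counit_left: "slice_left \<epsilon> (elem_of (\<Delta> a * (1 \<otimes>\<^sub>M mult_of a'))) = a * a'"
    and counit_right: "slice_right \<epsilon> (elem_of ((mult_of a \<otimes>\<^sub>M 1) * \<Delta> a')) = a * a'"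
    and antipode_left: "tensor_lift (\<lambda>x y. S x * y) (elem_of (\<Delta> a * (1 \<otimes>\<^sub>M mult_of a'))) = \<epsilon> a *\<^sub>C a'"
    and antipode_right: "tensor_lift (\<lambda>x y. x * S y) (elem_of ((mult_of a \<otimes>\<^sub>M 1) * \<Delta> a')) = \<epsilon> a' *\<^sub>C a"
begin

text \<open>
  The four ways to bring \<open>\<Delta>(a)\<close> into \<open>A \<otimes> A\<close>: the letter tells whether the covering factor stands to the
  right or to the left of the coproduct, the digit tells the leg it acts on. The arguments are in the order in
  which they are written: \<open>cov_r2 a c = \<Delta>(a)(1 \<otimes> c)\<close>, \<open>cov_l1 a c = (a \<otimes> 1)\<Delta>(c)\<close>.
\<close>

definition cov_r2 where "cov_r2 a c = elem_of (\<Delta> a * (1 \<otimes>\<^sub>M mult_of c))"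
definition cov_l1 where "cov_l1 a c = elem_of ((mult_of a \<otimes>\<^sub>M 1) * \<Delta> c)"
definition cov_r1 where "cov_r1 a c = elem_of (\<Delta> a * (mult_of c \<otimes>\<^sub>M 1))"
definition cov_l2 where "cov_l2 a c = elem_of ((1 \<otimes>\<^sub>M mult_of a) * \<Delta> c)"

lemma mult_of_cov:
  "mult_of (cov_r2 a c) = \<Delta> a * (1 \<otimes>\<^sub>M mult_of c)"
  "mult_of (cov_l1 a c) = (mult_of a \<otimes>\<^sub>M 1) * \<Delta> c"
  "mult_of (cov_r1 a c) = \<Delta> a * (mult_of c \<otimes>\<^sub>M 1)"
  "mult_of (cov_l2 a c) = (1 \<otimes>\<^sub>M mult_of a) * \<Delta> c"
  using regular unfolding regular_multiplier_hopf_algebra_def cov_r2_def cov_l1_def cov_r1_def cov_l2_def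
  by (simp_all only: mult_of_elem_of)

lemma coproduct_mult: "\<Delta> (a * b) = \<Delta> a * \<Delta> b"
  using regular unfolding regular_multiplier_hopf_algebra_def by blast

lemma clinear_coproduct: "clinear \<Delta>"
  using regular unfolding regular_multiplier_hopf_algebra_def by blast

lemma cbilinear_cov: "cbilinear cov_r2" "cbilinear cov_l1" "cbilinear cov_r1" "cbilinear cov_l2"
proof -
  note lin = mult_of_simps clinear_add[OF clinear_coproduct] clinear_scale[OF clinear_coproduct] mult_tensor_simps
  have inj: "s = t" if "mult_of s = mult_of t" for s t :: "('a, 'a) tensor" using that by simp
  show "cbilinear cov_r2" "cbilinear cov_l1" "cbilinear cov_r1" "cbilinear cov_l2"
    unfolding cbilinear_iff
    by (intro conjI allI; rule inj; simp add: lin mult_of_cov algebra_simps)+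
qed

lemmas clinear_cov = cbilinear_cov[unfolded cbilinear_def]

lemma inj_mult_of: "mult_of s = mult_of t \<Longrightarrow> s = t" for s t :: "('a, 'a) tensor"
  by simp

text \<open>
  Both sides are \<open>(x \<otimes> 1)\<Delta>(a)(1 \<otimes> c)\<close>. This lemma and the next three exchange one covering factor for
  another.
\<close>

lemma cov_l1_r2: "leg1 (\<lambda>u. x * u) (cov_r2 a c) = leg2 (\<lambda>v. v * c) (cov_l1 x a)"
  unfolding lmul_leg[symmetric] rmul_leg[symmetric]
  by (rule inj_mult_of) (simp add: mult_of_times_multiplier[symmetric] mult_of_cov mult.assoc)

lemma cov_r1_r2: "leg1 (\<lambda>u. u * x) (cov_r2 a c) = leg2 (\<lambda>v. v * c) (cov_r1 a x)"
  unfolding rmul_leg[symmetric]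
  by (rule inj_mult_of) (simp add: mult_of_times_multiplier[symmetric] mult_of_cov mult.assoc mult_of_legs)

lemma cov_l1_r1: "leg1 (\<lambda>u. u * z) (cov_l1 x a) = leg1 (\<lambda>u. x * u) (cov_r1 a z)"
  unfolding lmul_leg[symmetric] rmul_leg[symmetric]
  by (rule inj_mult_of) (simp add: mult_of_times_multiplier[symmetric] mult_of_cov mult.assoc)

lemma cov_l1_l2: "leg1 (\<lambda>u. x * u) (cov_l2 y a) = leg2 (\<lambda>v. y * v) (cov_l1 x a)"
  unfolding lmul_leg[symmetric] rmul_leg[symmetric]
  by (rule inj_mult_of) (simp add: mult_of_times_multiplier[symmetric] mult_of_cov mult.assoc[symmetric] mult_of_legs)

lemma lmul_coproduct_pure: 
  "lmul (\<Delta> a) (x \<otimes> c) = leg1 (\<lambda>u. u * x) (cov_r2 a c)"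
  "lmul (\<Delta> a) (x \<otimes> c) = leg2 (\<lambda>v. v * c) (cov_r1 a x)"
  unfolding cov_r1_r2[symmetric] rmul_leg[symmetric]
  by (rule inj_mult_of; simp add: mult_of_times_multiplier[symmetric] mult_of_cov mult.assoc mult_of_legs)+

lemma rmul_coproduct_pure: 
  "rmul (a \<otimes> x) (\<Delta> c) = leg2 (\<lambda>v. x * v) (cov_l1 a c)"
  unfolding lmul_leg[symmetric]
  by (rule inj_mult_of; simp add: mult_of_times_multiplier[symmetric] mult_of_cov mult.assoc[symmetric] mult_of_legs)

lemma cov_hom:
  "lmul (\<Delta> a) (cov_r2 b c) = cov_r2 (a * b) c"
  "lmul (\<Delta> a) (cov_r1 b c) = cov_r1 (a * b) c"
  "rmul (cov_l1 c b) (\<Delta> a) = cov_l1 c (b * a)"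
  by (rule inj_mult_of; simp add: mult_of_times_multiplier[symmetric] mult_of_cov mult.assoc coproduct_mult)+

text \<open>
  The canonical maps; \<open>T_r1\<close> is, up to a flip, the first canonical map of the flipped coproduct.
\<close>

definition T_r2 where "T_r2 = tensor_lift cov_r2"
definition T_l1 where "T_l1 = tensor_lift cov_l1"
definition T_r1 where "T_r1 = tensor_lift cov_r1"

lemma T_pure [simp]: "T_r2 (a \<otimes> c) = cov_r2 a c" "T_l1 (a \<otimes> c) = cov_l1 a c" "T_r1 (a \<otimes> c) = cov_r1 a c"
  by (simp_all add: T_r2_def T_l1_def T_r1_def tensor_lift_pure cbilinear_cov)

lemma clinear_T: "clinear T_r2" "clinear T_l1" "clinear T_r1"
  by (simp_all add: T_r2_def T_l1_def T_r1_def clinear_tensor_lift cbilinear_cov)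

lemma surj_T: "surj T_r2" "surj T_l1" "surj T_r1"
proof -
  have "bij (canonical_map_1 \<Delta>)" "bij (canonical_map_2 \<Delta>)" and b: "bij (canonical_map_1 (\<lambda>a. mult_flip (\<Delta> a)))"
    using regular unfolding regular_multiplier_hopf_algebra_def by blast+
  then show "surj T_r2" "surj T_l1"
    unfolding T_r2_def T_l1_def cov_r2_def cov_l1_def canonical_map_1_def canonical_map_2_def
    by (simp_all add: bij_is_surj)
  have "elem_of (mult_flip (\<Delta> a) * (1 \<otimes>\<^sub>M mult_of c)) = tensor_flip (cov_r1 a c)" for a c
  proof -
    have "mult_flip (\<Delta> a) * (1 \<otimes>\<^sub>M mult_of c) = mult_of (tensor_flip (cov_r1 a c))"
      unfolding mult_flip_mult_of[symmetric] mult_of_cov by (simp add: mult_flip_times mult_flip_tensor)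
    then show ?thesis by simp
  qed
  then have "canonical_map_1 (\<lambda>a. mult_flip (\<Delta> a)) t = tensor_flip (T_r1 t)" for t
    unfolding canonical_map_1_def T_r1_def
    by (simp add: clinear_of_tensor_lift clinear_tensor_flip cbilinear_cov)
  note T = this
  show "surj T_r1"
    unfolding surj_def
  proof
    fix s
    obtain t where "tensor_flip s = canonical_map_1 (\<lambda>a. mult_flip (\<Delta> a)) t"
      using bij_is_surj[OF b] by (rule surjE)
    then have "tensor_flip s = tensor_flip (T_r1 t)" by (simp add: T)
    then have "tensor_flip (tensor_flip s) = tensor_flip (tensor_flip (T_r1 t))" by (rule arg_cong)
    then have "s = T_r1 t" by (simp only: tensor_flip_flip)
    then show "\<exists>t. s = T_r1 t" by (rule exI)
  qed
qed

text \<open>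
  Coassociativity as an identity of tensors. Both multipliers in the definition are given by elements of
  \<open>A \<otimes> (A \<otimes> A)\<close>, on which \<open>mult_of\<close> is injective.
\<close>

lemma coassociativity: 
  "tensor_assoc (leg1 (cov_l1 a) (cov_r2 c a')) = leg2 (\<lambda>y. cov_r2 y a') (cov_l1 a c)"
proof -
  let ?L = "\<lambda>t. (mult_of a \<otimes>\<^sub>M 1 \<otimes>\<^sub>M 1) * coproduct_left \<Delta> t"
  let ?R = "\<lambda>t. coproduct_right \<Delta> t * (1 \<otimes>\<^sub>M (1 \<otimes>\<^sub>M mult_of a'))"
  note lin = mult_of_simps clinear_add[OF clinear_coproduct] clinear_scale[OF clinear_coproduct] mult_tensor_simps
  have bl: "cbilinear (\<lambda>x (y::'a). \<Delta> x \<otimes>\<^sub>M mult_of y)" and br: "cbilinear (\<lambda>(x::'a) y. mult_of x \<otimes>\<^sub>M \<Delta> y)"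
    unfolding cbilinear_iff by (simp_all add: lin)
  have L: "?L t = mult_of (leg1 (cov_l1 a) t)" for t
  proof (rule clinear_eq_on_tensors[where t = t])
    show "clinear ?L" unfolding coproduct_left_def
      by (intro clinear_compose[OF clinear_mult(1)] clinear_tensor_lift bl)
    show "clinear (\<lambda>t. mult_of (leg1 (cov_l1 a) t))"
      by (intro clinear_compose[OF clinear_mult_of] clinear_tensor_map clinear_cov[THEN conjunct1, rule_format] clinear_id)
    show "?L (x \<otimes> y) = mult_of (leg1 (cov_l1 a) (x \<otimes> y))" for x y
      by (simp add: coproduct_left_def tensor_lift_pure bl mult_tensor_times tensor_map_pure clinear_cov
        mult_tensor_mult_of[symmetric] mult_of_cov)
  qed
  have R: "?R t = mult_of (leg2 (\<lambda>y. cov_r2 y a') t)" for t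
  proof (rule clinear_eq_on_tensors[where t = t])
    show "clinear ?R" unfolding coproduct_right_def
      by (intro clinear_compose[OF clinear_mult(2)] clinear_tensor_lift br)
    show "clinear (\<lambda>t. mult_of (leg2 (\<lambda>y. cov_r2 y a') t))"
      by (intro clinear_compose[OF clinear_mult_of] clinear_tensor_map clinear_cov[THEN conjunct2, rule_format] clinear_id)
    show "?R (x \<otimes> y) = mult_of (leg2 (\<lambda>y. cov_r2 y a') (x \<otimes> y))" for x y
      by (simp add: coproduct_right_def tensor_lift_pure br mult_tensor_times tensor_map_pure clinear_cov
        mult_tensor_mult_of[symmetric] mult_of_cov)
  qed
  have "mult_assoc (?L (cov_r2 c a')) = ?R (cov_l1 a c)"
    using regular unfolding regular_multiplier_hopf_algebra_def coassociative_def cov_r2_def cov_l1_def by blast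
  then show ?thesis unfolding L R by (simp add: mult_assoc_mult_of)
qed

section \<open>The antipode inverts the canonical maps\<close>

definition mul_id_S where "mul_id_S = tensor_lift (\<lambda>x y. x * S y)"
definition mul_S_id where "mul_S_id = tensor_lift (\<lambda>x y. S x * y)"

lemma cbilinear_antipode: "cbilinear (\<lambda>x y. x * S y)" "cbilinear (\<lambda>x y. S x * y)"
  using clinear_S by (simp_all add: cbilinear_iff clinear_iff algebra_simps)

lemma clinear_mul_antipode: "clinear mul_id_S" "clinear mul_S_id"
  by (simp_all add: mul_id_S_def mul_S_id_def clinear_tensor_lift cbilinear_antipode)

lemma clinear_antipode_mult: "clinear (\<lambda>r. a * S r)" "clinear (\<lambda>r. S r * a)"
  using cbilinear_antipode by (simp_all add: cbilinear_def)

lemma S_inv [simp]: "S (inv S x) = x" "inv S (S x) = x"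
  using bij_S by (simp_all add: bij_is_surj surj_f_inv_f bij_is_inj)

lemma mul_antipode_pure [simp]: "mul_id_S (x \<otimes> y) = x * S y" "mul_S_id (x \<otimes> y) = S x * y"
  by (simp_all add: mul_id_S_def mul_S_id_def tensor_lift_pure cbilinear_antipode)

lemma S_zero_iff: "S x = 0 \<longleftrightarrow> x = 0"
  by (metis S_inv(2) clinear_0[OF clinear_S])

lemma clinear_inv_S: "clinear (inv S)"
  by (rule clinear_inv[OF clinear_S bij_S])

text \<open>
  If \<open>a \<otimes> x = \<Sum> (u \<otimes> 1)\<Delta>(v)\<close>, then \<open>\<Sum> u \<otimes> v c = \<Sum> a S(x\<^sub>1) \<otimes> x\<^sub>2 c\<close>, which is the familiar formula
  for the inverse of the canonical map, covered by \<open>c\<close>. It follows by applying \<open>x \<otimes> y \<mapsto> x S(y)\<close> to the first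
  two legs of the coassociativity identity.
\<close>

lemma T_l1_inverse:
  "leg2 (\<lambda>v. v * c) w = leg1 mul_id_S (tensor_assoc_inv (leg2 (\<lambda>y. cov_r2 y c) (T_l1 w)))"
proof (rule clinear_eq_on_tensors[where t = w])
  show "clinear (leg2 (\<lambda>v. v * c))" by (intro clinear_tensor_map clinear_id clinear_mult)
  show "clinear (\<lambda>w. leg1 mul_id_S (tensor_assoc_inv (leg2 (\<lambda>y. cov_r2 y c) (T_l1 w))))"
    by (intro clinear_compose[OF clinear_tensor_map] clinear_compose[OF clinear_tensor_assoc_inv]
      clinear_T clinear_id clinear_mul_antipode clinear_cov[THEN conjunct2, rule_format])
  fix u v
  have "leg1 mul_id_S (tensor_assoc_inv (leg2 (\<lambda>y. cov_r2 y c) (cov_l1 u v)))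
      = leg1 mul_id_S (leg1 (cov_l1 u) (cov_r2 v c))"
    by (simp add: coassociativity[symmetric])
  also have "\<dots> = leg1 (\<lambda>g. \<epsilon> g *\<^sub>C u) (cov_r2 v c)"
    by (simp add: tensor_map_tensor_map clinear_mul_antipode clinear_cov)
       (simp add: mul_id_S_def cov_l1_def antipode_right)
  also have "\<dots> = u \<otimes> (v * c)"
    by (simp add: leg1_scaleC clinear_counit cov_r2_def counit_left)
  finally show "leg2 (\<lambda>v. v * c) (u \<otimes> v) = leg1 mul_id_S (tensor_assoc_inv (leg2 (\<lambda>y. cov_r2 y c) (T_l1 (u \<otimes> v))))"
    by (simp add: tensor_map_pure clinear_mult)
qed

text \<open>
  The mirror image: if \<open>c \<otimes> a = \<Sum> \<Delta>(u)(1 \<otimes> v)\<close>, then \<open>\<Sum> x u \<otimes> v = \<Sum> x c\<^sub>1 \<otimes> S(c\<^sub>2) a\<close>.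
\<close>

lemma T_r2_inverse:
  "leg1 (\<lambda>u. x * u) w = leg2 mul_S_id (tensor_assoc (leg1 (cov_l1 x) (T_r2 w)))"
proof (rule clinear_eq_on_tensors[where t = w])
  show "clinear (leg1 (\<lambda>u. x * u))" by (intro clinear_tensor_map clinear_id clinear_mult)
  show "clinear (\<lambda>w. leg2 mul_S_id (tensor_assoc (leg1 (cov_l1 x) (T_r2 w))))"
    by (intro clinear_compose[OF clinear_tensor_map] clinear_compose[OF clinear_tensor_assoc]
      clinear_T clinear_id clinear_mul_antipode clinear_cov[THEN conjunct1, rule_format])
  fix u v
  have "leg2 mul_S_id (tensor_assoc (leg1 (cov_l1 x) (cov_r2 u v)))
      = leg2 mul_S_id (leg2 (\<lambda>y. cov_r2 y v) (cov_l1 x u))"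
    by (simp add: coassociativity)
  also have "\<dots> = leg2 (\<lambda>g. \<epsilon> g *\<^sub>C v) (cov_l1 x u)"
    by (simp add: tensor_map_tensor_map clinear_mul_antipode clinear_cov)
       (simp add: mul_S_id_def cov_r2_def antipode_left)
  also have "\<dots> = (x * u) \<otimes> v"
    by (simp add: leg2_scaleC clinear_counit cov_l1_def counit_right)
  finally show "leg1 (\<lambda>u. x * u) (u \<otimes> v) = leg2 mul_S_id (tensor_assoc (leg1 (cov_l1 x) (T_r2 (u \<otimes> v))))"
    by (simp add: tensor_map_pure clinear_mult)
qed

text \<open>
  The products span \<open>A\<close>: the counit maps \<open>\<Delta>(u)(1 \<otimes> v)\<close> to \<open>u v\<close>, and these elements span \<open>A \<otimes> A\<close>.
  If the counit were zero, then all products would vanish and \<open>A\<close> would be zero.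
\<close>

lemma clinear_eq_on_products:
  fixes f g :: "'a \<Rightarrow> 'c::complex_vector"
  assumes "clinear f" "clinear g" "\<And>x y. f (x * y) = g (x * y)"
  shows "f x = g x"
proof (cases "\<exists>e. \<epsilon> e \<noteq> 0")
  case True
  then obtain e' where e': "\<epsilon> e' \<noteq> 0" by blast
  define e where "e = (1 / \<epsilon> e') *\<^sub>C e'"
  have e: "\<epsilon> e = 1" using e' by (simp add: e_def clinear_scale[OF clinear_counit])
  obtain w where w: "e \<otimes> x = T_r2 w" using surj_T(1) by (metis surjD)
  have "f (slice_left \<epsilon> (T_r2 w)) = g (slice_left \<epsilon> (T_r2 w))" for w
  proof (rule clinear_eq_on_tensors[where t = w])
    show "clinear (\<lambda>w. f (slice_left \<epsilon> (T_r2 w)))" "clinear (\<lambda>w. g (slice_left \<epsilon> (T_r2 w)))"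
      by (intro clinear_compose[OF assms(1)] clinear_compose[OF assms(2)]
        clinear_compose[OF clinear_slice_left] clinear_counit clinear_T)+
    show "f (slice_left \<epsilon> (T_r2 (u \<otimes> v))) = g (slice_left \<epsilon> (T_r2 (u \<otimes> v)))" for u v
      by (simp add: cov_r2_def counit_left assms(3))
  qed
  from this[of w] show ?thesis
    unfolding w[symmetric] by (simp add: slice_left_pure clinear_counit e)
next
  case False
  then have "a * b = 0" for a b :: 'a
    using counit_left[of a b] by (simp add: slice_left_def tensor_lift_def free_lift_def case_prod_unfold)
  then have "x = 0" for x :: 'a using nondegenerate_left[of x] by blast
  then show ?thesis by (metis assms(1,2) clinear_0)
qed

end

section \<open>Strong invariance of integrals\<close>

locale left_invariant = multiplier_hopf \<Delta> S \<epsilon>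
  for \<Delta> :: "'a::nondegenerate_algebra coproduct" and S \<epsilon> +
  fixes \<phi> :: "'a \<Rightarrow> complex"
  assumes left_integral: "left_integral \<Delta> \<phi>"
begin

lemma clinear_phi: "clinear \<phi>"
  using left_integral by (simp add: left_integral_def)

lemma clinear_phi_mult: "clinear (\<lambda>v. \<phi> (x * v))" "clinear (\<lambda>v. \<phi> (v * x))"
  by (simp_all add: clinear_compose[OF clinear_phi] clinear_mult)

lemma phi_nonzero: obtains c where "\<phi> c = 1"
proof -
  obtain c' where c': "\<phi> c' \<noteq> 0" using left_integral unfolding left_integral_def by blast
  have "\<phi> ((1 / \<phi> c') *\<^sub>C c') = 1" using c' by (simp add: clinear_scale[OF clinear_phi])
  then show thesis by (rule that)
qed

lemma left_invariance:
  "slice_right \<phi> (T_l1 w) = slice_right \<phi> w"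
  "slice_right \<phi> (cov_r1 a c) = \<phi> a *\<^sub>C c"
  by (rule clinear_eq_on_tensors)
    (use left_integral in \<open>auto simp: clinear_slice_right clinear_phi cov_l1_def cov_r1_def slice_right_pure left_integral_def
      intro!: clinear_compose[OF clinear_slice_right] clinear_T\<close>)

text \<open>
  Informally \<open>\<phi>(x c\<^sub>2) a c\<^sub>1 = a S(x\<^sub>1) x\<^sub>2 c\<^sub>1 \<phi>(x\<^sub>3 c\<^sub>2) = a S(x\<^sub>1) \<phi>(x\<^sub>2 c)\<close>. Writing \<open>a \<otimes> x\<close> as
  \<open>\<Sum> (u \<otimes> 1)\<Delta>(v)\<close> replaces the insertion of \<open>S(x\<^sub>1) x\<^sub>2\<close>: invariance gives \<open>\<Sum> u \<phi>(v c)\<close>, and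
  \<open>\<Sum> u \<otimes> v c\<close> is known from the inverse of the canonical map.
\<close>

lemma strong_left_invariance:
  "slice_right \<phi> (leg2 (\<lambda>v. x * v) (cov_l1 a c)) = a * S (slice_right \<phi> (cov_r2 x c))"
proof -
  obtain w where w: "T_l1 w = a \<otimes> x" using surj_T(2) by (metis surjD)
  have r: "rmul (T_l1 w) (\<Delta> c) = T_l1 (leg2 (\<lambda>v. v * c) w)" for w
    by (rule clinear_eq_on_tensors)
      (auto intro!: clinear_compose[OF clinear_rmul] clinear_compose[OF clinear_T(2)] clinear_T clinear_tensor_map
        simp: clinear_mult cov_hom tensor_map_pure)
  have "slice_right \<phi> (leg2 (\<lambda>v. x * v) (cov_l1 a c)) = slice_right \<phi> (leg2 (\<lambda>v. v * c) w)"
    by (simp add: rmul_coproduct_pure[symmetric] w[symmetric] r left_invariance)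
  also have "leg2 (\<lambda>v. v * c) w = leg1 (\<lambda>r. a * S r) (cov_r2 x c)"
    by (simp add: T_l1_inverse w tensor_map_pure clinear_cov mul_id_S_def leg1_lift_assoc cbilinear_antipode)
  finally show ?thesis
    by (simp add: slice_right_tensor_map clinear_antipode_mult clinear_phi)
qed

end

locale right_invariant = multiplier_hopf \<Delta> S \<epsilon>
  for \<Delta> :: "'a::nondegenerate_algebra coproduct" and S \<epsilon> +
  fixes \<psi> :: "'a \<Rightarrow> complex"
  assumes right_integral: "right_integral \<Delta> \<psi>"
begin

lemma clinear_psi: "clinear \<psi>"
  using right_integral by (simp add: right_integral_def)

lemma clinear_psi_mult: "clinear (\<lambda>v. \<psi> (x * v))" "clinear (\<lambda>v. \<psi> (v * x))"
  by (simp_all add: clinear_compose[OF clinear_psi] clinear_mult)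

lemma psi_nonzero: obtains c where "\<psi> c = 1"
proof -
  obtain c' where c': "\<psi> c' \<noteq> 0" using right_integral unfolding right_integral_def by blast
  have "\<psi> ((1 / \<psi> c') *\<^sub>C c') = 1" using c' by (simp add: clinear_scale[OF clinear_psi])
  then show thesis by (rule that)
qed

lemma right_invariance: "slice_left \<psi> (T_r2 w) = slice_left \<psi> w"
  by (rule clinear_eq_on_tensors)
    (use right_integral in \<open>auto simp: clinear_slice_left clinear_psi cov_r2_def slice_left_pure right_integral_def
      intro!: clinear_compose[OF clinear_slice_left] clinear_T\<close>)

lemma lmul_T_r2: "lmul (\<Delta> x) (T_r2 w) = T_r2 (leg1 (\<lambda>u. x * u) w)"
    by (rule clinear_eq_on_tensors)
      (auto intro!: clinear_compose[OF clinear_lmul] clinear_compose[OF clinear_T(1)] clinear_T clinear_tensor_map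
        simp: clinear_mult cov_hom tensor_map_pure)

text \<open>
  The counterpart \<open>\<psi>(x\<^sub>1 c) x\<^sub>2 a = \<psi>(x c\<^sub>1) S(c\<^sub>2) a\<close> for a right integral.
\<close>

lemma strong_right_invariance:
  "slice_left \<psi> (lmul (\<Delta> x) (c \<otimes> a)) = S (slice_left \<psi> (cov_l1 x c)) * a"
proof -
  obtain w where w: "T_r2 w = c \<otimes> a" using surj_T(1) by (metis surjD)
  have "slice_left \<psi> (lmul (\<Delta> x) (c \<otimes> a)) = slice_left \<psi> (leg1 (\<lambda>u. x * u) w)"
    by (simp add: w[symmetric] lmul_T_r2 right_invariance)
  also have "leg1 (\<lambda>u. x * u) w = leg2 (\<lambda>r. S r * a) (cov_l1 x c)"
    by (simp add: T_r2_inverse w tensor_map_pure clinear_cov mul_S_id_def leg2_lift_assoc cbilinear_antipode)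
  finally show ?thesis
    by (simp add: slice_left_tensor_map clinear_antipode_mult clinear_psi)
qed

end

section \<open>Faithfulness of the left integral\<close>

context left_invariant
begin

lemma strong_left_invariance':
  "slice_right (\<lambda>v. \<phi> (x * v)) (cov_l1 a c) = a * S (slice_right \<phi> (cov_r2 x c))"
  using strong_left_invariance[of x a c] by (simp add: slice_right_tensor_map clinear_mult clinear_phi)

text \<open>
  The same identity with the covering factor on the other side of the coproduct.
\<close>

lemma strong_left_invariance_r1:
  "slice_right (\<lambda>v. \<phi> (x * v)) (cov_r1 c z) = S (slice_right \<phi> (cov_r2 x c)) * z"
proof (rule nondegenerate_eqI(2))
  fix a
  have "a * slice_right (\<lambda>v. \<phi> (x * v)) (cov_r1 c z) = slice_right (\<lambda>v. \<phi> (x * v)) (leg1 (\<lambda>u. a * u) (cov_r1 c z))"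
    by (simp add: slice_right_tensor_map clinear_mult clinear_phi_mult)
  also have "\<dots> = slice_right (\<lambda>v. \<phi> (x * v)) (cov_l1 a c) * z"
    by (simp add: cov_l1_r1[symmetric] slice_right_tensor_map clinear_mult clinear_phi_mult)
  finally show "a * slice_right (\<lambda>v. \<phi> (x * v)) (cov_r1 c z) = a * (S (slice_right \<phi> (cov_r2 x c)) * z)"
    by (simp add: strong_left_invariance' mult.assoc)
qed

lemma slice_cov_l1_right:
  "slice_right (\<lambda>v. \<phi> (v * c)) (cov_l1 a x) = a * slice_right \<phi> (cov_r2 x c)"
proof -
  have "slice_right (\<lambda>v. \<phi> (v * c)) (cov_l1 a x) = slice_right \<phi> (leg2 (\<lambda>v. v * c) (cov_l1 a x))"
    by (simp add: slice_right_tensor_map clinear_mult clinear_phi)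
  also have "\<dots> = a * slice_right \<phi> (cov_r2 x c)"
    by (simp add: cov_l1_r2[symmetric] slice_right_tensor_map clinear_mult clinear_phi)
  finally show ?thesis .
qed

lemma phi_products_nonzero: obtains x y where "\<phi> (x * y) \<noteq> 0"
proof -
  have "\<exists>x y. \<phi> (x * y) \<noteq> 0"
  proof (rule ccontr)
    assume "\<not> ?thesis"
    then have "\<phi> x = 0" for x
      using clinear_eq_on_products[OF clinear_phi clinear_zero, of x] by simp
    then show False by (metis phi_nonzero zero_neq_one)
  qed
  then show thesis using that by blast
qed

text \<open>
  The set \<open>N\<close> of all \<open>y\<close> with \<open>\<phi>(y A) = 0\<close> is a right ideal, and strong invariance shows that
  \<open>(z \<otimes> 1)\<Delta>(y) \<in> A \<otimes> N\<close> for \<open>y \<in> N\<close>. Hence \<open>\<epsilon>(y) S\<^sup>-\<^sup>1(z) = \<Sum> h S\<^sup>-\<^sup>1(g) \<in> N\<close>, where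
  \<open>\<Sum> g \<otimes> h = (z \<otimes> 1)\<Delta>(y)\<close>. If \<open>\<epsilon>\<close> did not vanish on \<open>N\<close>, this would give \<open>N = A\<close> and \<open>\<phi> = 0\<close>.
  So \<open>\<epsilon>\<close> vanishes on \<open>N\<close>, and then \<open>a x = (\<iota> \<otimes> \<epsilon>)((a \<otimes> 1)\<Delta>(x)) = 0\<close> for all \<open>a\<close>.
\<close>

lemma phi_faithful_left:
  assumes "\<And>c. \<phi> (x * c) = 0"
  shows "x = 0"
proof -
  let ?K = "range (\<lambda>c v. \<phi> (v * c))"
  have *: "cov_l1 z y \<in> complex_vector.span {g \<otimes> h | g h. \<forall>f\<in>?K. f h = 0}"
    if y: "\<And>c. \<phi> (y * c) = 0" for y z
  proof (rule slice_right_kernel)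
    show "clinear f" if "f \<in> ?K" for f using that clinear_phi_mult by auto
    have "slice_right \<phi> (cov_r2 y c) = 0" for c
    proof -
      have "a * S (slice_right \<phi> (cov_r2 y c)) = 0" for a
        unfolding strong_left_invariance'[symmetric] y slice_right_zero ..
      then have "S (slice_right \<phi> (cov_r2 y c)) = 0" using nondegenerate_right by blast
      then show ?thesis by (simp add: S_zero_iff)
    qed
    then show "slice_right f (cov_l1 z y) = 0" if "f \<in> ?K" for f
      using that by (auto simp: slice_cov_l1_right)
  qed
  have counit: "\<epsilon> y = 0" if y: "\<And>c. \<phi> (y * c) = 0" for y
  proof (rule ccontr)
    assume e: "\<epsilon> y \<noteq> 0"
    \<comment> \<open>\<open>S\<close> maps \<open>h S\<^sup>-\<^sup>1(g)\<close> to \<open>g S(h)\<close>, so the antipode axiom computes \<open>k\<close> up to \<open>S\<close>.\<close>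
    define k where "k = tensor_lift (\<lambda>g h. h * inv S g)"
    have bil: "cbilinear (\<lambda>g h. h * inv S g)"
      using clinear_inv_S by (simp add: cbilinear_iff clinear_iff algebra_simps)
    have lin: "clinear k" unfolding k_def by (rule clinear_tensor_lift[OF bil])
    have pure: "k (g \<otimes> h) = h * inv S g" for g h by (simp add: k_def tensor_lift_pure bil)
    have "S (k t) = mul_id_S t" for t
      by (rule clinear_eq_on_tensors)
        (simp_all add: clinear_compose[OF clinear_S] lin clinear_mul_antipode pure S_mult)
    then have "S (k (cov_l1 z y)) = \<epsilon> y *\<^sub>C z" for z
      by (simp add: mul_id_S_def cov_l1_def antipode_right)
    then have k: "k (cov_l1 (S z) y) = \<epsilon> y *\<^sub>C z" for z
      by (metis S_inv(2) clinear_scale[OF clinear_inv_S])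
    have "\<phi> (k (cov_l1 z y) * c) = 0" for z c
    proof (rule clinear_zero_on_span[OF _ _ *[OF y]])
      show "clinear (\<lambda>t. \<phi> (k t * c))"
        by (intro clinear_compose[OF clinear_phi] clinear_compose[OF clinear_mult(2)] lin)
      show "\<phi> (k t * c) = 0" if "t \<in> {g \<otimes> h | g h. \<forall>f\<in>?K. f h = 0}" for t
        using that by (auto simp: k_def tensor_lift_pure bil mult.assoc)
    qed
    from this[of "S _"] have "\<phi> (z * c) = 0" for z c
      using e by (simp add: k clinear_scale[OF clinear_phi])
    then show False by (metis phi_products_nonzero)
  qed
  have "a * x = 0" for a
  proof -
    have "slice_right \<epsilon> (cov_l1 a x) = 0"
    proof (rule clinear_zero_on_span[OF _ _ *[OF assms]])
      show "clinear (slice_right \<epsilon>)" by (rule clinear_slice_right[OF clinear_counit])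
      show "slice_right \<epsilon> t = 0" if "t \<in> {g \<otimes> h | g h. \<forall>f\<in>?K. f h = 0}" for t
        using that counit by (auto simp: slice_right_pure clinear_counit)
    qed
    then show ?thesis by (simp add: cov_l1_def counit_right)
  qed
  then show ?thesis using nondegenerate_right by blast
qed

text \<open>
  The same argument for the left ideal of all \<open>y\<close> with \<open>\<phi>(A y) = 0\<close>. The antipode identity is now
  \<open>\<Sum> S(g) h = \<epsilon>(y) S(z)\<close> with \<open>\<Sum> g \<otimes> h = \<Delta>(y)(z \<otimes> 1)\<close>, so that the factor from the ideal stands on the
  right.
\<close>

lemma phi_faithful_right:
  assumes "\<And>x. \<phi> (x * c) = 0"
  shows "c = 0"
proof -
  let ?K = "range (\<lambda>x v. \<phi> (x * v))"
  have lin: "clinear f" if "f \<in> ?K" for f using that clinear_phi_mult by auto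
  have zero: "slice_right \<phi> (cov_r2 x y) = 0" if y: "\<And>x. \<phi> (x * y) = 0" for x y
  proof -
    have "a * slice_right \<phi> (cov_r2 x y) = 0" for a
      unfolding slice_cov_l1_right[symmetric] y slice_right_zero ..
    then show ?thesis using nondegenerate_right by blast
  qed
  have counit: "\<epsilon> y = 0" if y: "\<And>x. \<phi> (x * y) = 0" for y
  proof (rule ccontr)
    assume e: "\<epsilon> y \<noteq> 0"
    have "mul_S_id (cov_r1 y z) = \<epsilon> y *\<^sub>C S z" for z
    proof (rule nondegenerate_eqI(1))
      fix a'
      have "mul_S_id (leg2 (\<lambda>v. v * a') t) = mul_S_id t * a'" "mul_S_id (leg1 (\<lambda>u. u * z) t) = S z * mul_S_id t" for t
        by (rule clinear_eq_on_tensors;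
          simp add: clinear_mult clinear_mul_antipode clinear_tensor_map clinear_compose[OF clinear_mul_antipode(2) clinear_tensor_map]
            clinear_compose[OF clinear_mult(1) clinear_mul_antipode(2)] clinear_compose[OF clinear_mult(2) clinear_mul_antipode(2)]
            tensor_map_pure S_mult mult.assoc)+
      then have "mul_S_id (cov_r1 y z) * a' = S z * mul_S_id (cov_r2 y a')"
        by (metis cov_r1_r2)
      then show "mul_S_id (cov_r1 y z) * a' = \<epsilon> y *\<^sub>C S z * a'"
        by (simp add: mul_S_id_def cov_r2_def antipode_left)
    qed
    moreover have "\<phi> (x * mul_S_id (cov_r1 y z)) = 0" for x z
    proof (rule clinear_zero_on_span[OF _ _ slice_right_kernel[of ?K, OF lin]])
      show "clinear (\<lambda>t. \<phi> (x * mul_S_id t))"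
        by (intro clinear_compose[OF clinear_phi] clinear_compose[OF clinear_mult(1)] clinear_mul_antipode)
      show "slice_right f (cov_r1 y z) = 0" if "f \<in> ?K" for f
        using that zero[OF y] by (auto simp: strong_left_invariance_r1 clinear_0[OF clinear_S])
      show "\<phi> (x * mul_S_id t) = 0" if "t \<in> {g \<otimes> h | g h. \<forall>f\<in>?K. f h = 0}" for t
        using that by (auto simp: mul_S_id_def tensor_lift_pure cbilinear_antipode mult.assoc[symmetric])
    qed
    ultimately have "\<phi> (x * S z) = 0" for x z
      using e by (simp add: clinear_scale[OF clinear_phi])
    then have "\<phi> (x * z) = 0" for x z by (metis S_inv(1))
    then show False by (metis phi_products_nonzero)
  qed
  have "a * c = 0" for a
  proof -
    have "slice_right \<epsilon> (cov_l1 a c) = 0"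
    proof (rule clinear_zero_on_span[OF _ _ slice_right_kernel[of ?K, OF lin]])
      show "clinear (slice_right \<epsilon>)" by (rule clinear_slice_right[OF clinear_counit])
      show "slice_right f (cov_l1 a c) = 0" if "f \<in> ?K" for f
        using that zero[OF assms] by (auto simp: strong_left_invariance' clinear_0[OF clinear_S])
      show "slice_right \<epsilon> t = 0" if "t \<in> {g \<otimes> h | g h. \<forall>f\<in>?K. f h = 0}" for t
        using that counit by (auto simp: slice_right_pure clinear_counit)
    qed
    then show ?thesis by (simp add: cov_l1_def counit_right)
  qed
  then show ?thesis using nondegenerate_right by blast
qed

end

section \<open>The dual and its actions\<close>

locale dual_pairing = left_invariant \<Delta> S \<epsilon> \<phi> + right_invariant \<Delta> S \<epsilon> \<psi>
  for \<Delta> :: "'a::nondegenerate_algebra coproduct" and S \<epsilon> \<phi> \<psi> +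
  fixes p :: "'a \<Rightarrow> 'b::nondegenerate_algebra \<Rightarrow> complex" and \<Delta>' :: "'b coproduct"
  assumes dual: "is_dual \<Delta> \<phi> p \<Delta>'"
begin

lemma cbilinear_p: "cbilinear p"
  using dual by (simp add: is_dual_def)

lemma clinear_p: "clinear (p x)" "clinear (\<lambda>x. p x b)"
  using cbilinear_p by (simp_all add: cbilinear_def)

lemma p_eqI_dual: "(\<And>x. p x b = p x b') \<Longrightarrow> b = b'"
  using dual unfolding is_dual_def bij_betw_def inj_on_def by auto

text \<open>
  The Fourier transform \<open>F(c) = \<phi>(\<cdot> c)\<close>. It is onto \<open>B\<close> by the definition of the dual and injective since
  \<open>\<phi>\<close> is faithful.
\<close>

definition F where "F c = (THE b. \<forall>x. p x b = \<phi> (x * c))"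

lemma p_F [simp]: "p x (F c) = \<phi> (x * c)"
proof -
  have "(\<lambda>a. \<phi> (a * c)) \<in> range (\<lambda>b a. p a b)"
    using dual unfolding is_dual_def bij_betw_def by auto
  then obtain b where b: "\<forall>x. p x b = \<phi> (x * c)" by (metis rangeE)
  have "\<forall>x. p x (F c) = \<phi> (x * c)"
    unfolding F_def by (rule theI[of _ b]) (use b p_eqI_dual in auto)
  then show ?thesis by simp
qed

lemma F_surj: obtains c where "b = F c"
proof -
  have "(\<lambda>a. p a b) \<in> {(\<lambda>a. \<phi> (a * c)) | c. True}"
    using dual unfolding is_dual_def bij_betw_def by blast
  then obtain c where "(\<lambda>a. p a b) = (\<lambda>a. \<phi> (a * c))" by blast
  then have "p x b = p x (F c)" for x by (simp add: fun_eq_iff)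
  then show thesis using that p_eqI_dual by blast
qed

lemma clinear_F: "clinear F"
  unfolding clinear_iff
  by (intro conjI allI; rule p_eqI_dual)
    (simp_all add: clinear_add[OF clinear_p(1)] clinear_scale[OF clinear_p(1)] algebra_simps
      clinear_add[OF clinear_phi] clinear_scale[OF clinear_phi])

lemma p_eqI:
  assumes "\<And>b. p x b = p y b"
  shows "x = y"
proof -
  have "\<phi> ((x - y) * c) = 0" for c
  proof -
    have "\<phi> ((x - y) * c) + p y (F c) = p x (F c)"
      by (simp add: clinear_add[OF clinear_phi, symmetric] algebra_simps)
    then show ?thesis by (simp only: assms) simp
  qed
  then show ?thesis using phi_faithful_left[of "x - y"] by simp
qed

lemma bij_F: "bij F"
proof (rule bijI)
  show "surj F" by (metis F_surj surj_def)
  show "inj F"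
  proof (rule injI)
    fix c c' assume "F c = F c'"
    then have "\<phi> (x * c) = \<phi> (x * c')" for x by (metis p_F)
    then have "\<phi> (x * (c - c')) = 0" for x
      using clinear_add[OF clinear_phi, of "x * (c - c')" "x * c'"] by (simp add: algebra_simps)
    then show "c = c'" using phi_faithful_right[of "c - c'"] by simp
  qed
qed

lemma F_inv [simp]: "F (inv F b) = b" "inv F (F c) = c"
  using bij_F by (simp_all add: bij_is_surj surj_f_inv_f bij_is_inj)

lemma clinear_inv_F: "clinear (inv F)"
  by (rule clinear_inv[OF clinear_F bij_F])

lemma tensor_lift_phi_phi:
  "tensor_lift (\<lambda>x y. \<phi> x * \<phi> y) t = \<phi> (slice_right \<phi> t)" (is ?r)
  "tensor_lift (\<lambda>x y. \<phi> x * \<phi> y) t = \<phi> (slice_left \<phi> t)" (is ?l)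
proof -
  have bil: "cbilinear (\<lambda>x y. \<phi> x * \<phi> y)"
    using clinear_phi by (simp add: cbilinear_iff clinear_iff algebra_simps)
  show ?r
    by (rule clinear_eq_on_tensors)
     (simp_all add: clinear_tensor_lift bil clinear_compose[OF clinear_phi clinear_slice_right] clinear_phi
       tensor_lift_pure slice_right_pure clinear_scale[OF clinear_phi])
  then show ?l by (simp add: slice_slice clinear_phi)
qed

lemma p_product:
  "p x (F c * F c') = p (slice_right \<phi> (cov_r2 x c')) (F c)"
  "p x (F c * F c') = p (slice_left \<phi> (cov_r1 x c)) (F c')"
proof -
  have "\<forall>a b b' c c'. (\<forall>x. p x b = \<phi> (x * c)) \<longrightarrow> (\<forall>x. p x b' = \<phi> (x * c')) \<longrightarrow>
      p a (b * b') = tensor_lift (\<lambda>x y. \<phi> x * \<phi> y) (lmul (\<Delta> a) (c \<otimes> c'))"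
    using dual unfolding is_dual_def by (elim conjE)
  then have k: "p x (F c * F c') = tensor_lift (\<lambda>x y. \<phi> x * \<phi> y) (lmul (\<Delta> x) (c \<otimes> c'))"
    by simp
  show "p x (F c * F c') = p (slice_right \<phi> (cov_r2 x c')) (F c)"
    unfolding k lmul_coproduct_pure(1) tensor_lift_phi_phi(1)
    by (simp add: slice_right_tensor_map clinear_mult clinear_phi)
  show "p x (F c * F c') = p (slice_left \<phi> (cov_r1 x c)) (F c')"
    unfolding k lmul_coproduct_pure(2) tensor_lift_phi_phi(2)
    by (simp add: slice_left_tensor_map clinear_mult clinear_phi)
qed

text \<open>
  The actions \<open>b \<triangleright> a\<close> and \<open>a \<triangleleft> b\<close> of the dual on \<open>A\<close>.
\<close>

definition lact where "lact b a = act_by_dual p b a"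
definition ract where "ract a b = (THE a'. \<forall>b'. p a' b' = p a (b * b'))"

lemma p_lact: "p (lact b a) b' = p a (b' * b)"
  and lact_F: "lact (F c) a = slice_right \<phi> (cov_r2 a c)"
proof -
  have *: "p (slice_right \<phi> (cov_r2 a c)) b' = p a (b' * F c)" for c b'
    by (rule F_surj[of b']) (simp only: p_product)
  have eq: "lact (F c) a = slice_right \<phi> (cov_r2 a c)" for c
    unfolding lact_def act_by_dual_def by (rule the_equality) (use * p_eqI in auto)
  then show "lact (F c) a = slice_right \<phi> (cov_r2 a c)" .
  show "p (lact b a) b' = p a (b' * b)"
    by (rule F_surj[of b]) (simp only: eq *)
qed

lemma p_ract: "p (ract a b) b' = p a (b * b')"
  and ract_F: "ract a (F c) = slice_left \<phi> (cov_r1 a c)"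
proof -
  have *: "p (slice_left \<phi> (cov_r1 a c)) b' = p a (F c * b')" for c b'
    by (rule F_surj[of b']) (simp only: p_product(2))
  have eq: "ract a (F c) = slice_left \<phi> (cov_r1 a c)" for c
    unfolding ract_def by (rule the_equality) (use * p_eqI in auto)
  then show "ract a (F c) = slice_left \<phi> (cov_r1 a c)" .
  show "p (ract a b) b' = p a (b * b')"
    by (rule F_surj[of b]) (simp only: eq *)
qed

lemma p_act_on_dual: "p x (act_on_dual p a b) = p (x * a) b"
  and act_on_dual_F: "act_on_dual p a (F c) = F (a * c)"
proof -
  have eq: "act_on_dual p a (F c) = F (a * c)" for c
    unfolding act_on_dual_def by (rule the_equality) (auto intro: p_eqI_dual simp: mult.assoc)
  then show "act_on_dual p a (F c) = F (a * c)" .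
  show "p x (act_on_dual p a b) = p (x * a) b"
    by (rule F_surj[of b]) (simp add: eq mult.assoc)
qed

lemma lact_ract: "lact b (ract x b') = ract (lact b x) b'"
  by (rule p_eqI) (simp add: p_lact p_ract mult.assoc)

lemma lact_mult: "lact (b * b') x = lact b (lact b' x)"
  by (rule p_eqI) (simp add: p_lact mult.assoc)

lemma ract_mult: "ract x (b * b') = ract (ract x b) b'"
  by (rule p_eqI) (simp add: p_ract mult.assoc)

lemma cbilinear_lact: "cbilinear lact"
  unfolding cbilinear_iff
  by (intro conjI allI; rule p_eqI)
    (simp_all add: p_lact clinear_add[OF clinear_p(1)] clinear_add[OF clinear_p(2)]
      clinear_scale[OF clinear_p(1)] clinear_scale[OF clinear_p(2)] algebra_simps)

lemma cbilinear_ract: "cbilinear ract"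
  unfolding cbilinear_iff
  by (intro conjI allI; rule p_eqI)
    (simp_all add: p_ract clinear_add[OF clinear_p(1)] clinear_add[OF clinear_p(2)]
      clinear_scale[OF clinear_p(1)] clinear_scale[OF clinear_p(2)] algebra_simps)

lemma lact_slice: "slice_right (\<lambda>y. p y b) (cov_l1 x z) = x * lact b z"
  by (rule F_surj[of b]) (simp add: slice_cov_l1_right lact_F)

lemma ract_slice: "slice_left (\<lambda>y. p y b) (cov_r2 z c) = ract z b * c"
proof -
  obtain e where b: "b = F e" by (rule F_surj)
  have "slice_left (\<lambda>y. p y b) (cov_r2 z c) = slice_left \<phi> (leg1 (\<lambda>u. u * e) (cov_r2 z c))"
    by (simp add: b slice_left_tensor_map clinear_mult clinear_phi)
  then show ?thesis
    by (simp add: b ract_F cov_r1_r2 slice_left_tensor_map clinear_mult clinear_phi)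
qed

text \<open>
  The elements \<open>b \<triangleright> a\<close> span \<open>A\<close>: if \<open>\<phi>(c) = 1\<close>, then \<open>x\<close> is the slice of \<open>x \<otimes> c\<close> by \<open>\<phi>\<close>, and
  \<open>x \<otimes> c\<close> is a sum of elements \<open>\<Delta>(u)(1 \<otimes> v)\<close>, whose slices are \<open>F(v) \<triangleright> u\<close>.
\<close>

lemma clinear_eq_on_lact:
  fixes f g :: "'a \<Rightarrow> 'c::complex_vector"
  assumes f: "clinear f" and g: "clinear g" and "\<And>b a. f (lact b a) = g (lact b a)"
  shows "f x = g x"
proof -
  obtain c where c: "\<phi> c = 1" by (rule phi_nonzero)
  obtain w where w: "x \<otimes> c = T_r2 w" using surj_T(1) by (metis surjD)
  have "f (slice_right \<phi> (T_r2 w)) = g (slice_right \<phi> (T_r2 w))"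
    by (rule clinear_eq_on_tensors)
      (simp_all add: clinear_compose[OF f] clinear_compose[OF g] clinear_compose[OF clinear_slice_right clinear_T(1)]
        clinear_phi assms(3) lact_F[symmetric])
  then show ?thesis by (simp add: w[symmetric] slice_right_pure clinear_phi c)
qed

text \<open>
  The elements \<open>a \<triangleright> b\<close> span \<open>B\<close> because \<open>a \<triangleright> F(c) = F(a c)\<close> and the products span \<open>A\<close>.
\<close>

lemma clinear_eq_on_act_on_dual:
  fixes f g :: "'b \<Rightarrow> 'c::complex_vector"
  assumes f: "clinear f" and g: "clinear g" and "\<And>a b. f (act_on_dual p a b) = g (act_on_dual p a b)"
  shows "f b = g b"
proof -
  have "f (F c) = g (F c)" for c
    by (rule clinear_eq_on_products) (simp_all add: clinear_compose clinear_F f g act_on_dual_F[symmetric] assms(3))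
  then show ?thesis by (metis F_surj)
qed

section \<open>Pairing with multipliers\<close>

text \<open>
  The value at \<open>x\<close> of the linear map \<open>A \<rightarrow> A\<close> given by an element of \<open>B \<otimes> A\<close>.
\<close>

definition slice_at where "slice_at x = slice_left (p x)"

lemma slice_at_pure: "slice_at x (b \<otimes> a) = p x b *\<^sub>C a"
  by (simp add: slice_at_def slice_left_pure clinear_p)

lemma clinear_slice_at: "clinear (slice_at x)"
  by (simp add: slice_at_def clinear_slice_left clinear_p)

lemma slice_at_eqI:
  assumes "\<And>x. slice_at x s = slice_at x t"
  shows "s = t"
proof -
  have "s - t = 0"
  proof (rule slice_left_separates)
    show "clinear f" if "f \<in> range p" for f using that clinear_p by auto
    show "b = 0" if "\<And>f. f \<in> range p \<Longrightarrow> f b = 0" for b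
      by (rule p_eqI_dual) (use that in \<open>auto simp: clinear_0[OF clinear_p(1)]\<close>)
    show "slice_left f (s - t) = 0" if "f \<in> range p" for f
    proof -
      have "slice_at x (s - t) = 0" for x
        using clinear_add[OF clinear_slice_at, of x "s - t" t] assms[of x] by simp
      then show ?thesis using that by (auto simp: slice_at_def)
    qed
  qed
  then show ?thesis by simp
qed

lemma slice_at_mult: "slice_at x ((b \<otimes> a) * t) = a * slice_at (ract x b) t" "slice_at x (t * (b \<otimes> a)) = slice_at (lact b x) t * a"
  by (rule clinear_eq_on_tensors;
    simp add: clinear_compose[OF clinear_slice_at] clinear_times_tensor clinear_compose[OF clinear_mult(1)]
      clinear_compose[OF clinear_mult(2)] clinear_slice_at mult_pure_tensor slice_at_pure p_ract p_lact)+

lemma tensor_pairing_slice_at: "tensor_pairing (\<lambda>b a. p a b) p t (a' \<otimes> b') = p (slice_at a' t) b'"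
proof -
  have bil: "cbilinear (\<lambda>z w. p z x * p y w)" for x y
    using clinear_p by (simp add: cbilinear_iff clinear_iff algebra_simps)
  have bil': "cbilinear (\<lambda>x y. p a' x * p y b')"
    using clinear_p by (simp add: cbilinear_iff clinear_iff algebra_simps)
  show ?thesis
    unfolding tensor_pairing_def tensor_lift_pure[OF bil]
    by (rule clinear_eq_on_tensors)
      (simp_all add: clinear_tensor_lift bil' clinear_compose[OF clinear_p(2) clinear_slice_at] tensor_lift_pure slice_at_pure
        clinear_scale[OF clinear_p(2)])
qed

lemma clinear_eq_on_actions:
  fixes G H :: "('a, 'b) tensor \<Rightarrow> complex"
  assumes G: "clinear G" and H: "clinear H"
    and eq: "\<And>a b a' b'. G (lact b a' \<otimes> act_on_dual p a b') = H (lact b a' \<otimes> act_on_dual p a b')"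
  shows "G t = H t"
proof (rule clinear_eq_on_tensors[OF G H])
  fix x y
  show "G (x \<otimes> y) = H (x \<otimes> y)"
  proof (rule clinear_eq_on_lact[where x = x])
    fix b a'
    show "G (lact b a' \<otimes> y) = H (lact b a' \<otimes> y)"
      by (rule clinear_eq_on_act_on_dual[where b = y])
        (simp_all add: eq clinear_compose[OF G] clinear_compose[OF H] clinear_pure_tensor)
  qed (simp_all add: clinear_compose[OF G] clinear_compose[OF H] clinear_pure_tensor)
qed

lemma multiplier_pairing_eqI:
  assumes H: "clinear H"
    and eq: "\<And>a b a' b'. H (lact b a' \<otimes> act_on_dual p a b') = p (slice_at a' (lmul m (b \<otimes> a))) b'"
  shows "multiplier_pairing p m = H"
  unfolding multiplier_pairing_def tensor_pairing_slice_at lact_def[symmetric]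
proof (rule the_equality)
  fix G assume "clinear G \<and> (\<forall>a b a' b'. G (lact b a' \<otimes> act_on_dual p a b') = p (slice_at a' (lmul m (b \<otimes> a))) b')"
  then show "G = H"
    by (intro ext) (rule clinear_eq_on_actions, simp_all add: H eq)
qed (use assms in auto)

text \<open>
  The functional \<open>F(c) \<mapsto> \<epsilon>(c)\<close>, an integral of the dual. Lemma \<open>phi_hat_mult\<close> shows that \<open>A\<close> consists of the
  functionals \<open>phi_hat(\<cdot> b)\<close> on \<open>B\<close>, which is the duality between \<open>A\<close> and the dual of \<open>B\<close>.
\<close>

definition phi_hat where "phi_hat b = \<epsilon> (inv F b)"

lemma clinear_phi_hat: "clinear phi_hat"
  using clinear_compose[OF clinear_counit clinear_inv_F] by (simp add: phi_hat_def[abs_def])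

text \<open>
  By strong invariance \<open>F(e) F(c) = F(d)\<close> with \<open>d = \<Sum> \<phi>(S\<^sup>-\<^sup>1(c\<^sub>1) e) c\<^sub>2\<close>, and
  \<open>\<epsilon>(d) = \<phi>(S\<^sup>-\<^sup>1(c) e) = \<langle>S\<^sup>-\<^sup>1(c), F(e)\<rangle>\<close>. To cover the coproduct, \<open>e\<close> is taken to be a product \<open>x y\<close>
  and \<open>x\<close> is moved to the argument of \<open>S\<^sup>-\<^sup>1\<close>.
\<close>

lemma phi_hat_mult: "phi_hat (b * F c) = p (inv S c) b"
proof -
  obtain e where b: "b = F e" by (rule F_surj)
  have "phi_hat (F e * F c) = p (inv S c) (F e)"
  proof (rule clinear_eq_on_products[where x = e])
    show "clinear (\<lambda>e. phi_hat (F e * F c))" "clinear (\<lambda>e. p (inv S c) (F e))"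
      by (intro clinear_compose[OF clinear_phi_hat] clinear_compose[OF clinear_mult(2)] clinear_F clinear_compose[OF clinear_p(1)])+
    fix x y
    define f where "f u = \<phi> (inv S u * y)" for u
    have f: "clinear f" unfolding f_def
      by (intro clinear_compose[OF clinear_phi] clinear_compose[OF clinear_mult(2)] clinear_inv_S)
    \<comment> \<open>\<open>f(S(x) u) = \<phi>(S\<^sup>-\<^sup>1(u) x y)\<close>: the covering factor \<open>S(x)\<close> turns into the first factor of \<open>e = x y\<close>\<close>
    define d where "d = slice_left f (cov_l1 (S x) c)"
    have "F (x * y) * F c = F d"
    proof (rule p_eqI_dual)
      fix z
      have "p z (F d) = f (slice_right (\<lambda>v. \<phi> (z * v)) (cov_l1 (S x) c))"
        by (simp add: d_def slice_slice[OF f clinear_phi_mult(1)])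
      also have "\<dots> = f (S (slice_right \<phi> (cov_r2 z c) * x))"
        by (simp add: strong_left_invariance' S_mult)
      also have "\<dots> = p z (F (x * y) * F c)"
        by (simp only: p_product(1)) (simp add: f_def mult.assoc)
      finally show "p z (F (x * y) * F c) = p z (F d)" ..
    qed
    then have "phi_hat (F (x * y) * F c) = \<epsilon> d" by (simp add: phi_hat_def)
    also have "\<dots> = f (S x * c)"
      by (simp add: d_def slice_slice[OF f clinear_counit, symmetric] cov_l1_def counit_right)
    also have "\<dots> = f (S (inv S c * x))" by (simp add: S_mult)
    also have "\<dots> = p (inv S c) (F (x * y))"
      by (simp add: f_def mult.assoc del: S_mult)
    finally show "phi_hat (F (x * y) * F c) = p (inv S c) (F (x * y))" .
  qed
  then show ?thesis by (simp only: b)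
qed

text \<open>
  The map \<open>a \<mapsto> F(S(a))\<close> is an isomorphism of left \<open>B\<close>-modules from \<open>A\<close> to \<open>B\<close>.
\<close>

lemma mult_F: "b * F (S a) = F (S (lact b a))"
proof -
  define d where "d = inv F (b * F (S a))"
  have "inv S d = lact b a"
  proof (rule p_eqI)
    fix b'
    have "p (inv S d) b' = phi_hat (b' * b * F (S a))"
      by (simp add: phi_hat_mult[symmetric] d_def mult.assoc)
    then show "p (inv S d) b' = p (lact b a) b'" by (simp add: phi_hat_mult p_lact)
  qed
  then have "S (lact b a) = d" by (metis S_inv(1))
  then show ?thesis by (simp add: d_def)
qed

text \<open>
  The functional in the definition of the pairing exists for every multiplier \<open>m\<close>. The isomorphism
  \<open>Z : x \<otimes> F(c) \<mapsto> F(S(x)) \<otimes> c\<close> of left \<open>B \<otimes> A\<close>-modules from \<open>A \<otimes> B\<close> to \<open>B \<otimes> A\<close> turns the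
  pairing of \<open>B \<otimes> A\<close> with \<open>A \<otimes> B\<close> into \<open>\<langle>s, u\<rangle> = (phi_hat \<otimes> \<phi>)(s Z(u))\<close>. In this form \<open>s\<close> may be replaced
  by \<open>m\<close>, since \<open>m Z(u)\<close> lies in \<open>B \<otimes> A\<close>.
\<close>

lemma multiplier_pairing_actions:
  "multiplier_pairing p m (lact b a' \<otimes> act_on_dual p a b') = p (slice_at a' (lmul m (b \<otimes> a))) b'"
proof -
  define \<Phi> where "\<Phi> = tensor_lift (\<lambda>b a. phi_hat b * \<phi> a)"
  have bil: "cbilinear (\<lambda>b a. phi_hat b * \<phi> a)"
    using clinear_phi clinear_phi_hat by (simp add: cbilinear_iff clinear_iff algebra_simps)
  have lin: "clinear \<Phi>" unfolding \<Phi>_def by (rule clinear_tensor_lift[OF bil])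
  have pure: "\<Phi> (b \<otimes> a) = phi_hat b * \<phi> a" for b a by (simp add: \<Phi>_def tensor_lift_pure bil)
  have \<Phi>: "\<Phi> (t * (F (S x) \<otimes> c)) = p (slice_at x t) (F c)" for t x c
    by (rule clinear_eq_on_tensors)
      (simp_all add: clinear_compose[OF lin] clinear_times_tensor clinear_compose[OF clinear_phi] clinear_compose[OF clinear_mult(2) clinear_slice_at]
        p_F mult_pure_tensor pure phi_hat_mult slice_at_pure clinear_scale[OF clinear_phi])
  define Z where "Z = tensor_lift (\<lambda>a b. F (S a) \<otimes> inv F b)"
  have bilZ: "cbilinear (\<lambda>a b. F (S a) \<otimes> inv F b)"
    by (intro cbilinear_pureI clinear_compose[OF clinear_F] clinear_S clinear_inv_F)
  have linZ: "clinear Z" unfolding Z_def by (rule clinear_tensor_lift[OF bilZ])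
  define H where "H t = \<Phi> (lmul m (Z t))" for t
  have linH: "clinear H" unfolding H_def
    by (intro clinear_compose[OF lin] clinear_compose[OF clinear_lmul] linZ)
  have H: "H (lact b a' \<otimes> act_on_dual p a b') = p (slice_at a' (lmul m (b \<otimes> a))) b'" for b a a' b'
  proof -
    obtain c where b': "b' = F c" by (rule F_surj)
    have "Z (lact b a' \<otimes> act_on_dual p a b') = (b \<otimes> a) * (F (S a') \<otimes> c)"
      by (simp add: Z_def tensor_lift_pure bilZ b' act_on_dual_F mult_F mult_pure_tensor)
    then show ?thesis
      by (simp only: H_def lmul_mult \<Phi> b')
  qed
  show ?thesis
    by (simp add: multiplier_pairing_eqI[OF linH H] H)
qed

section \<open>Left and right integrals define the same functionals\<close>

text \<open>
  Apply \<open>\<psi> \<otimes> \<phi>\<close> to \<open>\<Delta>(x) t\<close>. If \<open>t = \<Delta>(u)(1 \<otimes> v)\<close>, right invariance gives \<open>\<psi>(x u) \<phi>(v)\<close>; if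
  \<open>t = \<Delta>(v)(u \<otimes> 1)\<close>, left invariance gives \<open>\<phi>(x v) \<psi>(u)\<close>. Every \<open>t\<close> is a sum of terms of either kind.
\<close>

lemma left_right_integral_exchange:
  assumes "T_r2 w = T_r1 w'"
  shows "\<psi> (x * slice_right \<phi> w) = \<phi> (x * slice_right \<psi> w')"
proof -
  have lmul: "lmul (\<Delta> x) (T_r1 w) = T_r1 (leg1 (\<lambda>u. x * u) w)" for w
    by (rule clinear_eq_on_tensors)
      (auto intro!: clinear_compose[OF clinear_lmul] clinear_compose[OF clinear_T(3)] clinear_T clinear_tensor_map
        simp: clinear_mult cov_hom tensor_map_pure)
  have inv: "slice_right \<phi> (T_r1 w) = slice_left \<phi> w" for w
    by (rule clinear_eq_on_tensors)
      (simp_all add: clinear_compose[OF clinear_slice_right clinear_T(3)] clinear_phi clinear_slice_left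
        slice_left_pure left_invariance)
  have "\<psi> (x * slice_right \<phi> w) = \<psi> (slice_right \<phi> (leg1 (\<lambda>u. x * u) w))"
    by (simp add: slice_right_tensor_map clinear_mult clinear_phi)
  also have "\<dots> = \<phi> (slice_left \<psi> (lmul (\<Delta> x) (T_r2 w)))"
    by (simp add: slice_slice clinear_phi clinear_psi lmul_T_r2 right_invariance)
  also have "\<dots> = \<psi> (slice_right \<phi> (lmul (\<Delta> x) (T_r1 w')))"
    by (simp add: slice_slice clinear_phi clinear_psi assms)
  also have "\<dots> = \<psi> (slice_left \<phi> (leg1 (\<lambda>u. x * u) w'))"
    by (simp add: lmul inv)
  also have "\<dots> = \<phi> (slice_right \<psi> (leg1 (\<lambda>u. x * u) w'))"
    by (simp add: slice_slice clinear_phi clinear_psi)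
  also have "\<dots> = \<phi> (x * slice_right \<psi> w')"
    by (simp add: slice_right_tensor_map clinear_mult clinear_psi)
  finally show ?thesis .
qed

lemma psi_functional: "\<exists>c. \<forall>x. \<psi> (x * u) = \<phi> (x * c)"
proof -
  obtain v where v: "\<phi> v = 1" by (rule phi_nonzero)
  obtain w' where "T_r2 (u \<otimes> v) = T_r1 w'" using surj_T(3) by (metis surjD)
  from left_right_integral_exchange[OF this] show ?thesis
    by (auto simp: slice_right_pure clinear_phi v)
qed

lemma phi_functional: "\<exists>u. \<forall>x. \<phi> (x * v) = \<psi> (x * u)"
proof -
  obtain u where u: "\<psi> u = 1" by (rule psi_nonzero)
  obtain w where "T_r1 (v \<otimes> u) = T_r2 w" using surj_T(1) by (metis surjD)
  from left_right_integral_exchange[OF this[symmetric]] show ?thesis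
    by (metis slice_right_pure clinear_psi u scaleC_one)
qed

text \<open>
  The Fourier transform with respect to the right integral. It is well defined and onto since the
  functionals \<open>\<psi>(\<cdot> u)\<close> are the elements of \<open>B\<close>.
\<close>

definition G where "G u = (THE b. \<forall>x. p x b = \<psi> (x * u))"

lemma p_G [simp]: "p x (G u) = \<psi> (x * u)"
proof -
  obtain c where c: "\<And>x. \<psi> (x * u) = \<phi> (x * c)" using psi_functional by blast
  have "G u = F c" unfolding G_def
    by (rule the_equality) (auto intro: p_eqI_dual simp: c)
  then show ?thesis by (simp add: c)
qed

lemma G_surj: obtains u where "b = G u"
proof -
  obtain c where b: "b = F c" by (rule F_surj)
  obtain u where "\<forall>x. \<phi> (x * c) = \<psi> (x * u)" using phi_functional by blast
  then have "b = G u" by (intro p_eqI_dual) (simp add: b)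
  then show thesis by (rule that)
qed

lemma clinear_G: "clinear G"
  unfolding clinear_iff
  by (intro conjI allI; rule p_eqI_dual)
    (simp_all add: clinear_add[OF clinear_p(1)] clinear_scale[OF clinear_p(1)] algebra_simps
      clinear_add[OF clinear_psi] clinear_scale[OF clinear_psi])

lemma ract_G: "ract x (G c) = S (slice_left \<psi> (cov_l1 x c))"
proof (rule nondegenerate_eqI(1))
  fix a
  have "ract x (G c) * a = slice_left \<psi> (leg1 (\<lambda>u. u * c) (cov_r2 x a))"
    by (simp add: ract_slice[symmetric] slice_left_tensor_map clinear_mult clinear_psi)
  then show "ract x (G c) * a = S (slice_left \<psi> (cov_l1 x c)) * a"
    by (simp add: lmul_coproduct_pure(1)[symmetric] strong_right_invariance)
qed

section \<open>Multipliers from linear maps\<close>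

text \<open>
  The two hypotheses provide \<open>W(b \<otimes> a)\<close> and \<open>(b \<otimes> a)W\<close>. The multiplier identities hold after evaluation in
  the first leg: the module properties express that \<open>\<triangleright>\<close> and \<open>\<triangleleft>\<close> are actions, and the compatibility of
  the two sides is \<open>b' \<triangleright> (x \<triangleleft> b) = (b' \<triangleright> x) \<triangleleft> b\<close>.
\<close>

lemma multiplier_of_linear_map:
  assumes \<sigma>: "clinear \<sigma>"
    and left: "\<And>b a. \<exists>t. \<forall>x. slice_at x t = \<sigma> (lact b x) * a"
    and right: "\<And>b a. \<exists>t. \<forall>x. slice_at x t = a * \<sigma> (ract x b)"
  shows "\<exists>W. \<forall>a b. multiplier_pairing p W (a \<otimes> b) = p (\<sigma> a) b"
proof -
  define l where "l b a = (SOME t. \<forall>x. slice_at x t = \<sigma> (lact b x) * a)" for b a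
  have l: "slice_at x (l b a) = \<sigma> (lact b x) * a" for b a x
    using someI_ex[OF left[of b a]] unfolding l_def by blast
  define r where "r b a = (SOME t. \<forall>x. slice_at x t = a * \<sigma> (ract x b))" for b a
  have r: "slice_at x (r b a) = a * \<sigma> (ract x b)" for b a x
    using someI_ex[OF right[of a b]] unfolding r_def by blast
  note lin = clinear_add[OF \<sigma>] clinear_scale[OF \<sigma>] cbilinear_lact[unfolded cbilinear_iff] cbilinear_ract[unfolded cbilinear_iff]
    clinear_add[OF clinear_slice_at] clinear_scale[OF clinear_slice_at]
  have bil: "cbilinear l" "cbilinear r"
    unfolding cbilinear_iff by (intro conjI allI; rule slice_at_eqI; simp add: l r lin algebra_simps)+
  define L where "L = tensor_lift l"
  define R where "R = tensor_lift r"
  have LR: "L (b \<otimes> a) = l b a" "R (b \<otimes> a) = r b a" for b a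
    by (simp_all add: L_def R_def tensor_lift_pure bil)
  have linLR: "clinear L" "clinear R"
    by (simp_all add: L_def R_def clinear_tensor_lift bil)
  have slL: "slice_at x (L (t * (b \<otimes> a))) = slice_at (lact b x) (L t) * a" for x t b a
    by (rule clinear_eq_on_tensors)
      (simp_all add: clinear_compose[OF clinear_slice_at] clinear_compose[OF linLR(1)] clinear_times_tensor linLR
        clinear_compose[OF clinear_mult(2)] mult_pure_tensor LR l lact_mult mult.assoc)
  have slR: "slice_at x (R ((b \<otimes> a) * t)) = a * slice_at (ract x b) (R t)" for x t b a
    by (rule clinear_eq_on_tensors)
      (simp_all add: clinear_compose[OF clinear_slice_at] clinear_compose[OF linLR(2)] clinear_times_tensor linLR
        clinear_compose[OF clinear_mult(1)] mult_pure_tensor LR r ract_mult mult.assoc)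
  have Lmult: "L (t * s) = L t * s" for s t
  proof (rule clinear_eq_on_tensors[where t = s])
    show "L (t * (b \<otimes> a)) = L t * (b \<otimes> a)" for b a
      by (rule slice_at_eqI) (simp add: slL slice_at_mult)
  qed (simp_all add: clinear_compose[OF linLR(1)] clinear_times_tensor)
  have Rmult: "R (s * t) = s * R t" for s t
  proof (rule clinear_eq_on_tensors[where t = s])
    show "R ((b \<otimes> a) * t) = (b \<otimes> a) * R t" for b a
      by (rule slice_at_eqI) (simp add: slR slice_at_mult)
  qed (simp_all add: clinear_compose[OF linLR(2)] clinear_times_tensor)
  have compat: "s * L t = R s * t" for s t
  proof (induction s t rule: tensor_induct_pair)
    case (pure b a b' a')
    show ?case
      by (rule slice_at_eqI) (simp add: slice_at_mult LR l r lact_ract mult.assoc)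
  qed (simp_all add: clinear_add[OF linLR(1)] clinear_add[OF linLR(2)] algebra_simps)
  define W where "W = Abs_multiplier (L, R)"
  have "is_multiplier (L, R)"
    by (simp add: is_multiplier_def linLR Lmult Rmult compat)
  then have W: "lmul W = L"
    by (simp add: W_def lmul.rep_eq Abs_multiplier_inverse)
  define H where "H = tensor_lift (\<lambda>a b. p (\<sigma> a) b)"
  have bilH: "cbilinear (\<lambda>a b. p (\<sigma> a) b)"
    by (rule cbilinear_compose[OF cbilinear_p \<sigma> clinear_id])
  have "multiplier_pairing p W = H"
  proof (rule multiplier_pairing_eqI)
    show "clinear H" by (simp add: H_def clinear_tensor_lift bilH)
    show "H (lact b a' \<otimes> act_on_dual p a b') = p (slice_at a' (lmul W (b \<otimes> a))) b'" for a b a' b'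
      by (simp add: H_def tensor_lift_pure bilH p_act_on_dual W LR l)
  qed
  then show ?thesis by (intro exI[of _ W]) (simp add: H_def tensor_lift_pure bilH)
qed

lemma slice_at_F_tensor:
  assumes f: "clinear f"
  shows "slice_at x (tensor_lift (\<lambda>g h. F h \<otimes> f g) s) = f (slice_right (\<lambda>h. \<phi> (x * h)) s)"
proof -
  have bil: "cbilinear (\<lambda>g h. F h \<otimes> f g)"
    using clinear_F f by (simp add: cbilinear_iff clinear_iff pure_tensor_simps)
  show ?thesis
    by (rule clinear_eq_on_tensors)
      (simp_all add: clinear_compose[OF clinear_slice_at] clinear_tensor_lift bil clinear_compose[OF f]
        clinear_slice_right clinear_phi_mult tensor_lift_pure slice_at_pure slice_right_pure clinear_scale[OF f])
qed

lemma slice_at_G_tensor: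
  assumes f: "clinear f"
  shows "slice_at x (tensor_lift (\<lambda>g h. G g \<otimes> f h) s) = f (slice_left (\<lambda>g. \<psi> (x * g)) s)"
proof -
  have bil: "cbilinear (\<lambda>g h. G g \<otimes> f h)"
    using clinear_G f by (simp add: cbilinear_iff clinear_iff pure_tensor_simps)
  show ?thesis
    by (rule clinear_eq_on_tensors)
      (simp_all add: clinear_compose[OF clinear_slice_at] clinear_tensor_lift bil clinear_compose[OF f]
        clinear_slice_left clinear_psi_mult tensor_lift_pure slice_at_pure slice_left_pure clinear_scale[OF f])
qed

lemma slice_left_psi_cov:
  "slice_left (\<lambda>g. \<psi> (x * g)) (cov_r2 c a) = slice_left \<psi> (cov_l1 x c) * a"
  "slice_left (\<lambda>g. \<psi> (x * g)) (cov_l2 a c) = a * slice_left \<psi> (cov_l1 x c)"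
proof -
  have *: "slice_left (\<lambda>g. \<psi> (x * g)) t = slice_left \<psi> (leg1 (\<lambda>u. x * u) t)" for t :: "('a, 'a) tensor"
    by (simp add: slice_left_tensor_map clinear_mult clinear_psi)
  show "slice_left (\<lambda>g. \<psi> (x * g)) (cov_r2 c a) = slice_left \<psi> (cov_l1 x c) * a"
    "slice_left (\<lambda>g. \<psi> (x * g)) (cov_l2 a c) = a * slice_left \<psi> (cov_l1 x c)"
    unfolding * cov_l1_r2 cov_l1_l2 by (simp_all add: slice_left_tensor_map clinear_mult clinear_psi)
qed

text \<open>
  For \<open>b = F(c)\<close>, strong invariance gives \<open>S((b \<triangleright> x) a) = S(a) S(b \<triangleright> x) = \<Sum> \<phi>(x h) g\<close> with
  \<open>\<Sum> g \<otimes> h = (S(a) \<otimes> 1)\<Delta>(c)\<close>, so that \<open>V(b \<otimes> a) = \<Sum> F(h) \<otimes> S\<^sup>-\<^sup>1(g)\<close>. Likewise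
  \<open>(b \<otimes> a)V = \<Sum> G(g) \<otimes> S(h)\<close> for \<open>b = G(c)\<close> and \<open>\<Sum> g \<otimes> h = \<Delta>(c)(1 \<otimes> S\<^sup>-\<^sup>1(a))\<close>.
\<close>

lemma canonical_multiplier: "\<exists>V. \<forall>a b. multiplier_pairing p V (a \<otimes> b) = p a b"
proof (rule multiplier_of_linear_map[OF clinear_id])
  fix b a
  obtain c where b: "b = F c" by (rule F_surj)
  have "slice_at x (tensor_lift (\<lambda>g h. F h \<otimes> inv S g) (cov_l1 (S a) c)) = lact b x * a" for x
  proof -
    have "slice_at x (tensor_lift (\<lambda>g h. F h \<otimes> inv S g) (cov_l1 (S a) c)) = inv S (S (lact b x * a))"
      by (simp only: slice_at_F_tensor clinear_inv_S strong_left_invariance' S_mult b lact_F)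
    then show ?thesis by simp
  qed
  then show "\<exists>t. \<forall>x. slice_at x t = lact b x * a" by blast
next
  fix b a
  obtain c where b: "b = G c" by (rule G_surj)
  have "slice_at x (tensor_lift (\<lambda>g h. G g \<otimes> S h) (cov_r2 c (inv S a))) = a * ract x b" for x
    by (simp add: slice_at_G_tensor clinear_S slice_left_psi_cov S_mult ract_G b)
  then show "\<exists>t. \<forall>x. slice_at x t = a * ract x b" by blast
qed

text \<open>
  Now \<open>S(b \<triangleright> x) a\<close> is given by strong invariance itself. For the other side \<open>a S(x \<triangleleft> b)\<close> contains
  \<open>S\<^sup>2\<close> of a slice, and \<open>a\<close> enters it as \<open>S\<^sup>-\<^sup>2(a)\<close> on the left; this uses the covering
  \<open>(1 \<otimes> S\<^sup>-\<^sup>2(a))\<Delta>(c)\<close>.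
\<close>

lemma antipode_multiplier: "\<exists>W. \<forall>a b. multiplier_pairing p W (a \<otimes> b) = p (S a) b"
proof (rule multiplier_of_linear_map[OF clinear_S])
  fix b a
  obtain c where b: "b = F c" by (rule F_surj)
  have "slice_at x (tensor_lift (\<lambda>g h. F h \<otimes> g) (cov_r1 c a)) = S (lact b x) * a" for x
    by (simp add: slice_at_F_tensor strong_left_invariance_r1 b lact_F)
  then show "\<exists>t. \<forall>x. slice_at x t = S (lact b x) * a" by blast
next
  fix b a
  obtain c where b: "b = G c" by (rule G_surj)
  have "slice_at x (tensor_lift (\<lambda>g h. G g \<otimes> S (S h)) (cov_l2 (inv S (inv S a)) c)) = a * S (ract x b)" for x
    by (simp add: slice_at_G_tensor clinear_compose[OF clinear_S clinear_S] slice_left_psi_cov S_mult ract_G b)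
  then show "\<exists>t. \<forall>x. slice_at x t = a * S (ract x b)" by blast
qed

text \<open>
  The pairing of \<open>V\<close> determines all \<open>\<langle>V(b \<otimes> a), a' \<otimes> b'\<rangle>\<close>, and the pairing of \<open>B \<otimes> A\<close> with \<open>A \<otimes> B\<close> is
  non-degenerate.
\<close>

lemma multiplier_pairing_inject:
  assumes "\<And>a b. multiplier_pairing p V (a \<otimes> b) = multiplier_pairing p W (a \<otimes> b)"
  shows "V = W"
proof (rule multiplier_eq_of_lmul)
  fix t
  show "lmul V t = lmul W t"
  proof (rule clinear_eq_on_tensors[OF clinear_lmul clinear_lmul])
    fix b a
    show "lmul V (b \<otimes> a) = lmul W (b \<otimes> a)"
      by (intro slice_at_eqI p_eqI) (simp add: multiplier_pairing_actions[symmetric] assms)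
  qed
qed

section \<open>The antipode of the dual\<close>

lemma counit_lact: "\<epsilon> (lact b a) = p a b"
proof -
  obtain c where "b = F c" by (rule F_surj)
  then show ?thesis
    by (simp add: lact_F slice_slice clinear_counit clinear_phi cov_r2_def counit_left)
qed

lemma cbilinear_p_p: "cbilinear (\<lambda>z w. p x z * p y w)" "cbilinear (\<lambda>x y. p x z * p y w)"
  using clinear_p by (simp_all add: cbilinear_iff clinear_iff algebra_simps)

lemma tensor_pairing_pure_left:
  "tensor_pairing p p (x \<otimes> y) t = tensor_lift (\<lambda>z w. p x z * p y w) t"
proof -
  have "cbilinear (\<lambda>x y. tensor_lift (\<lambda>z w. p x z * p y w) t)"
  proof (induction t rule: tensor_induct)
    case (pure z w)
    then show ?case by (simp add: tensor_lift_pure cbilinear_p_p)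
  next
    case (add s t)
    then show ?case
      unfolding cbilinear_iff clinear_add[OF clinear_tensor_lift[OF cbilinear_p_p(1)]]
      by (simp add: distrib_left add_ac)
  qed
  then show ?thesis by (simp add: tensor_pairing_def tensor_lift_pure)
qed

lemma tensor_pairing_pure_right:
  "tensor_pairing p p s (b \<otimes> b') = p (slice_right (\<lambda>y. p y b') s) b"
  unfolding tensor_pairing_def tensor_lift_pure[OF cbilinear_p_p(1)]
  by (rule clinear_eq_on_tensors)
    (simp_all add: clinear_tensor_lift cbilinear_p_p clinear_compose[OF clinear_p(2) clinear_slice_right] clinear_p
      tensor_lift_pure slice_right_pure clinear_scale[OF clinear_p(2)])

definition dual_cov where "dual_cov b b' = elem_of (\<Delta>' b * (1 \<otimes>\<^sub>M mult_of b'))"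

lemma tensor_pairing_dual_cov:
  "tensor_pairing p p (a \<otimes> a') (dual_cov b b') = tensor_pairing p p (cov_l1 a a') (b \<otimes> b')"
proof -
  have "\<exists>t. \<Delta>' b * (1 \<otimes>\<^sub>M mult_of b') = mult_of t \<and>
      (\<forall>a a'. tensor_pairing p p (a \<otimes> a') t =
        tensor_pairing p p (elem_of ((mult_of a \<otimes>\<^sub>M 1) * \<Delta> a')) (b \<otimes> b'))"
    using dual unfolding is_dual_def by (elim conjE) simp
  then show ?thesis by (auto simp: dual_cov_def cov_l1_def)
qed

text \<open>
  The coproduct of \<open>B\<close> is brought back to that of \<open>A\<close>: with \<open>\<Sum> b\<^sub>1 \<otimes> b\<^sub>2 = \<Delta>'(F(c))(1 \<otimes> b')\<close>, the tensor
  \<open>\<Sum> b\<^sub>2 \<triangleright> a \<otimes> b\<^sub>1\<close> of \<open>A \<otimes> B\<close> is \<open>(\<iota> \<otimes> F)(\<Delta>(b' \<triangleright> a)(1 \<otimes> c))\<close>. Paired with \<open>y \<in> B\<close> and \<open>x \<in> A\<close>,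
  both sides become \<open>\<phi>(x (z \<triangleleft> y) c)\<close> with \<open>z = b' \<triangleright> a\<close>.
\<close>

lemma dual_cov_act:
  "tensor_lift (\<lambda>b1 b2. lact b2 a \<otimes> b1) (dual_cov (F c) b') = leg2 F (cov_r2 (lact b' a) c)"
  (is "tensor_lift ?k _ = ?r")
proof -
  have bil: "cbilinear ?k"
    using cbilinear_lact by (simp add: cbilinear_iff pure_tensor_simps)
  have "p x (slice_left (\<lambda>u. p u y) (tensor_lift ?k (dual_cov (F c) b'))) = p x (slice_left (\<lambda>u. p u y) ?r)" for x y
  proof -
    have move: "p (lact b2 a) y = p (ract a y) b2" for b2 by (simp add: p_lact p_ract)
    have "p x (slice_left (\<lambda>u. p u y) (tensor_lift ?k t)) = tensor_lift (\<lambda>b1 b2. p x b1 * p (ract a y) b2) t" for t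
      by (rule clinear_eq_on_tensors)
        (simp_all add: clinear_compose[OF clinear_p(1)] clinear_compose[OF clinear_slice_left] clinear_p
          clinear_tensor_lift bil cbilinear_p_p tensor_lift_pure slice_left_pure clinear_scale[OF clinear_p(1)] move)
    then have "p x (slice_left (\<lambda>u. p u y) (tensor_lift ?k (dual_cov (F c) b')))
        = p (x * lact b' (ract a y)) (F c)"
      by (simp only: tensor_pairing_pure_left[symmetric] tensor_pairing_dual_cov tensor_pairing_pure_right lact_slice)
    also have "\<dots> = p x (F (ract (lact b' a) y * c))"
      by (simp add: lact_ract mult.assoc)
    also have "\<dots> = p x (slice_left (\<lambda>u. p u y) ?r)"
      by (simp only: slice_left_tensor_map clinear_id clinear_F clinear_p ract_slice)
    finally show ?thesis .
  qed
  then have eq: "slice_left (\<lambda>u. p u y) (tensor_lift ?k (dual_cov (F c) b')) = slice_left (\<lambda>u. p u y) ?r" for y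
    by (rule p_eqI_dual)
  have "tensor_lift ?k (dual_cov (F c) b') - ?r = 0"
  proof (rule slice_left_separates)
    show "clinear f" if "f \<in> range (\<lambda>y u. p u y)" for f using that clinear_p by auto
    show "x = 0" if "\<And>f. f \<in> range (\<lambda>y u. p u y) \<Longrightarrow> f x = 0" for x
      by (rule p_eqI) (use that in \<open>auto simp: clinear_0[OF clinear_p(2)]\<close>)
    show "slice_left f (tensor_lift ?k (dual_cov (F c) b') - ?r) = 0" if f: "f \<in> range (\<lambda>y u. p u y)" for f
    proof -
      obtain y where f: "f = (\<lambda>u. p u y)" using f by blast
      then show ?thesis
        using clinear_add[OF clinear_slice_left[OF clinear_p(2)], of y "tensor_lift ?k (dual_cov (F c) b') - ?r" ?r] eq[of y]
        by simp
    qed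
  qed
  then show ?thesis by simp
qed

lemma clinear_eq_on_cov_r2_lact:
  fixes f g :: "('a, 'a) tensor \<Rightarrow> 'c::complex_vector"
  assumes f: "clinear f" and g: "clinear g" and eq: "\<And>b a c. f (cov_r2 (lact b a) c) = g (cov_r2 (lact b a) c)"
  shows "f t = g t"
proof -
  have "f (cov_r2 z c) = g (cov_r2 z c)" for z c
    by (rule clinear_eq_on_lact[where x = z])
      (simp_all add: clinear_compose[OF f] clinear_compose[OF g] clinear_cov eq)
  then have "f (T_r2 w) = g (T_r2 w)" for w
    by (rule_tac clinear_eq_on_tensors[where t = w]) (simp_all add: clinear_compose[OF f] clinear_compose[OF g] clinear_T)
  moreover obtain w where "t = T_r2 w" using surj_T(1) by (rule surjE)
  ultimately show ?thesis by simp
qed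

text \<open>
  Applying a linear map to both sides of the previous identity compares an axiom of \<open>B\<close> with one of \<open>A\<close>, on the
  elements \<open>\<Delta>(z)(1 \<otimes> c)\<close> with \<open>z = b' \<triangleright> a\<close>, which span \<open>A \<otimes> A\<close>. The counit axiom of \<open>B\<close> yields \<open>\<epsilon>'(F(c)) = \<phi>(c)\<close>. The
  antipode axiom of \<open>B\<close> then yields \<open>\<epsilon>'(F(c)) \<langle>a, b'\<rangle> = \<phi>(c) \<epsilon>(z)\<close> for the functional
  \<open>r \<otimes> s \<mapsto> \<langle>r, S'(F(s))\<rangle>\<close>, and the antipode axiom of \<open>A\<close> yields the same value for
  \<open>r \<otimes> s \<mapsto> \<phi>(S(r) s) = \<langle>S(r), F(s)\<rangle>\<close>. So the two functionals are equal.
\<close>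

lemma antipode_dual:
  assumes S': "is_antipode \<Delta>' S'"
  shows "p (S a) b = p a (S' b)"
proof -
  obtain \<epsilon>' where e': "is_counit \<Delta>' \<epsilon>'" and
    anti: "\<And>b b'. tensor_lift (\<lambda>x y. S' x * y) (dual_cov b b') = \<epsilon>' b *\<^sub>C b'"
    using S' unfolding is_antipode_def dual_cov_def by blast
  have lin_e: "clinear \<epsilon>'" and counit: "\<And>b b'. slice_left \<epsilon>' (dual_cov b b') = b * b'"
    using e' unfolding is_counit_def dual_cov_def by blast+
  have lin_S: "clinear S'" using S' by (simp add: is_antipode_def)
  have bil: "cbilinear (\<lambda>b1 b2. lact b2 a \<otimes> b1)" for a
    using cbilinear_lact by (simp add: cbilinear_iff pure_tensor_simps)
  have lin_lact: "clinear (\<lambda>b. lact b a)" for a using cbilinear_lact by (simp add: cbilinear_def)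
  have lin_eF: "clinear (\<lambda>x. \<epsilon>' (F x))" by (rule clinear_compose[OF lin_e clinear_F])
  have e_F: "\<epsilon>' (F c) = \<phi> c" for c
  proof -
    have "slice_right (\<lambda>c. \<epsilon>' (F c)) t = slice_right \<phi> t" for t :: "('a, 'a) tensor"
    proof (rule clinear_eq_on_cov_r2_lact[where t = t])
      fix b a c
      have "slice_right \<epsilon>' (tensor_lift (\<lambda>b1 b2. lact b2 a \<otimes> b1) t) = lact (slice_left \<epsilon>' t) a" for t
        by (rule clinear_eq_on_tensors)
          (simp_all add: clinear_compose[OF clinear_slice_right] clinear_compose[OF lin_lact] clinear_slice_left
            clinear_tensor_lift bil lin_e tensor_lift_pure slice_left_pure slice_right_pure clinear_scale[OF lin_lact])
      from this[of "dual_cov (F c) b"]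
      have "slice_right \<epsilon>' (leg2 F (cov_r2 (lact b a) c)) = lact (F c) (lact b a)"
        by (simp add: dual_cov_act counit lact_mult)
      then show "slice_right (\<lambda>c. \<epsilon>' (F c)) (cov_r2 (lact b a) c) = slice_right \<phi> (cov_r2 (lact b a) c)"
        by (simp add: slice_right_tensor_map clinear_F lin_e lact_F)
    qed (simp_all add: clinear_slice_right lin_eF clinear_phi)
    note eq = this
    obtain e where e: "\<phi> e = 1" by (rule phi_nonzero)
    have "\<epsilon>' (F c) *\<^sub>C e = \<phi> c *\<^sub>C e"
      using eq[of "e \<otimes> c"] by (simp only: slice_right_pure lin_eF clinear_phi)
    then have "\<phi> (\<epsilon>' (F c) *\<^sub>C e) = \<phi> (\<phi> c *\<^sub>C e)" by (rule arg_cong)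
    then show ?thesis by (simp add: clinear_scale[OF clinear_phi] e)
  qed
  have bil1: "cbilinear (\<lambda>r b. p r (S' b))"
    by (rule cbilinear_compose[OF cbilinear_p clinear_id lin_S])
  have bil2: "cbilinear (\<lambda>r s. p (S r) (F s))"
    by (rule cbilinear_compose[OF cbilinear_p clinear_S clinear_F])
  have bil3: "cbilinear (\<lambda>x y. S' x * y)"
    using lin_S by (simp add: cbilinear_iff clinear_iff algebra_simps)
  have "tensor_lift (\<lambda>r s. p r (S' (F s))) t = tensor_lift (\<lambda>r s. p (S r) (F s)) t" for t
  proof (rule clinear_eq_on_cov_r2_lact[where t = t])
    fix b a c
    have "tensor_lift (\<lambda>r b. p r (S' b)) (tensor_lift (\<lambda>b1 b2. lact b2 a \<otimes> b1) t)
        = p a (tensor_lift (\<lambda>x y. S' x * y) t)" for t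
      by (rule clinear_eq_on_tensors)
        (simp_all add: clinear_compose[OF clinear_tensor_lift[OF bil1]] clinear_compose[OF clinear_p(1)]
          clinear_tensor_lift bil bil3 tensor_lift_pure bil1 p_lact)
    from this[of "dual_cov (F c) b"]
    have "tensor_lift (\<lambda>r s. p r (S' (F s))) (cov_r2 (lact b a) c) = \<phi> c * p a b"
      by (simp add: dual_cov_act anti e_F clinear_scale[OF clinear_p(1)] tensor_lift_tensor_map bil1 clinear_F)
    moreover have "tensor_lift (\<lambda>r s. p (S r) (F s)) t = \<phi> (mul_S_id t)" for t
      by (rule clinear_eq_on_tensors)
        (simp_all add: clinear_tensor_lift[OF bil2[simplified]] tensor_lift_pure[OF bil2[simplified]] clinear_compose[OF clinear_phi clinear_mul_antipode(2)])
    ultimately show "tensor_lift (\<lambda>r s. p r (S' (F s))) (cov_r2 (lact b a) c) = tensor_lift (\<lambda>r s. p (S r) (F s)) (cov_r2 (lact b a) c)"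
      by (simp add: mul_S_id_def cov_r2_def antipode_left clinear_scale[OF clinear_phi] counit_lact)
  qed (intro clinear_tensor_lift cbilinear_compose[OF cbilinear_p] clinear_id clinear_S clinear_compose[OF lin_S] clinear_F)+
  note eq = this
  obtain c where b: "b = F c" by (rule F_surj)
  have "tensor_lift (\<lambda>r s. p r (S' (F s))) (a \<otimes> c) = p a (S' (F c))"
    by (rule tensor_lift_pure, rule cbilinear_compose[OF cbilinear_p clinear_id clinear_compose[OF lin_S clinear_F]])
  then show ?thesis using eq[of "a \<otimes> c"] by (simp only: tensor_lift_pure[OF bil2] b)
qed

end

theorem proposition3p10:
  fixes \<Delta> :: "'a::nondegenerate_algebra coproduct"
    and \<phi> :: "'a \<Rightarrow> complex"
    and p :: "'a \<Rightarrow> 'b::nondegenerate_algebra \<Rightarrow> complex"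
    and \<Delta>' :: "'b coproduct"
    and S :: "'a \<Rightarrow> 'a" and S' :: "'b \<Rightarrow> 'b"
  assumes "algebraic_quantum_group \<Delta>"
    and "left_integral \<Delta> \<phi>"
    and "is_dual \<Delta> \<phi> p \<Delta>'"
    and "is_antipode \<Delta> S" and "is_antipode \<Delta>' S'"
  shows "(\<exists>!V :: ('b, 'a) tensor multiplier. \<forall>a b. multiplier_pairing p V (a \<otimes> b) = p a b) \<and>
    (\<forall>V :: ('b, 'a) tensor multiplier. (\<forall>a b. multiplier_pairing p V (a \<otimes> b) = p a b) \<longrightarrow>
      (\<exists>W :: ('b, 'a) tensor multiplier. \<forall>a b.
        multiplier_pairing p W (a \<otimes> b) = multiplier_pairing p V (a \<otimes> S' b)) \<and>
      (\<exists>W :: ('b, 'a) tensor multiplier. \<forall>a b.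
        multiplier_pairing p W (a \<otimes> b) = multiplier_pairing p V (S a \<otimes> b)))"
proof -
  obtain \<psi> where \<psi>: "right_integral \<Delta> \<psi>" and reg: "regular_multiplier_hopf_algebra \<Delta>"
    using assms(1) by (auto simp: algebraic_quantum_group_def)
  have S: "clinear S" "bij S" "\<And>a a'. S (a * a') = S a' * S a"
    using assms(4) unfolding is_antipode_def by blast+
  obtain \<epsilon> where \<epsilon>: "is_counit \<Delta> \<epsilon>"
    and SL: "\<And>a a'. tensor_lift (\<lambda>x y. S x * y) (elem_of (\<Delta> a * (1 \<otimes>\<^sub>M mult_of a'))) = \<epsilon> a *\<^sub>C a'"
    and SR: "\<And>a a'. tensor_lift (\<lambda>x y. x * S y) (elem_of ((mult_of a \<otimes>\<^sub>M 1) * \<Delta> a')) = \<epsilon> a' *\<^sub>C a"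
    using assms(4) unfolding is_antipode_def by blast
  have e: "clinear \<epsilon>" "\<And>a a'. slice_left \<epsilon> (elem_of (\<Delta> a * (1 \<otimes>\<^sub>M mult_of a'))) = a * a'"
    "\<And>a a'. slice_right \<epsilon> (elem_of ((mult_of a \<otimes>\<^sub>M 1) * \<Delta> a')) = a * a'"
    using \<epsilon> unfolding is_counit_def by blast+
  have "multiplier_hopf \<Delta> S \<epsilon>"
    by (rule multiplier_hopf.intro[OF reg S e SL SR])
  then have "left_invariant \<Delta> S \<epsilon> \<phi>" "right_invariant \<Delta> S \<epsilon> \<psi>"
    using assms(2) \<psi>
    by (simp_all only: left_invariant_def left_invariant_axioms_def right_invariant_def right_invariant_axioms_def)
  then interpret dual_pairing \<Delta> S \<epsilon> \<phi> \<psi> p \<Delta>'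
    using assms(3) by (simp only: dual_pairing_def dual_pairing_axioms_def)
  obtain W where W: "\<forall>a b. multiplier_pairing p W (a \<otimes> b) = p (S a) b"
    using antipode_multiplier by (rule exE)
  show ?thesis
  proof (intro conjI allI impI)
    show "\<exists>!V. \<forall>a b. multiplier_pairing p V (a \<otimes> b) = p a b"
    proof (rule ex_ex1I[OF canonical_multiplier])
      show "V = V'" if "\<forall>a b. multiplier_pairing p V (a \<otimes> b) = p a b" "\<forall>a b. multiplier_pairing p V' (a \<otimes> b) = p a b"
        for V V' using that by (intro multiplier_pairing_inject) simp
    qed
    fix V assume V: "\<forall>a b. multiplier_pairing p V (a \<otimes> b) = p a b"
    show "\<exists>W. \<forall>a b. multiplier_pairing p W (a \<otimes> b) = multiplier_pairing p V (a \<otimes> S' b)"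
      using V W antipode_dual[OF assms(5)] by auto
    show "\<exists>W. \<forall>a b. multiplier_pairing p W (a \<otimes> b) = multiplier_pairing p V (S a \<otimes> b)"
      using V W by auto
  qed
qed

end
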